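(* Given an $(\mathbf m,\mathbf A_\circ,\mathbf B)$-Collatz dynamics (as defined in the context, together with $\boldsymbol\lambda_{\mathbf r}$, $\boldsymbol\mu_{\mathbf r}$, $R_w$ and the vector generating functions $\mathbf f_k$ and $\mathbf F$), the following statements hold. (S2.a) Let $\mathbf z\in\mathbb D_*^d$. Then there exist unique complex numbers $\{\sigma_{\mathbf r,j,l}(z_j)\}$ and $\{\tau_{\mathbf r,j,l}(z_j)\}$, a finite nonempty set $\mathcal L(\mathbf r)\subseteq\mathbb N_0^{d+1}$ (of pairs $(\boldsymbol\ell,\nu)$ with $\boldsymbol\ell\in\mathbb N_0^d$, $\nu\in\mathbb N_0$) with $(\mathbf 0,0)\in\mathcal L(\mathbf r)$, complex numbers $\{\eta_{\mathbf r,\boldsymbol\ell,\nu}(\mathbf z)\}$, and $d$-dimensional complex vectors $\{\boldsymbol\varphi_{\mathbf r,\boldsymbol\ell,\nu}(\mathbf z)\}$ such that $$\begin{aligned}\prod_{j=1}^d\frac{1}{u_j^{\mu_{\mathbf r,j}-\lambda_{\mathbf r,j}+1}(u_j^{\lambda_{\mathbf r,j}}-z_j^{m_j})}&=\prod_{j=1}^d\frac{1}{u_j^{\mu_{\mathbf r,j}-\lambda_{\mathbf r,j}+1}\prod_{l=0}^{\lambda_{\mathbf r,j}-1}(u_j-\phi_{\mathbf r,j,l}(z_j))}\\&=\prod_{j=1}^d\left(\sum_{l=0}^{\mu_{\mathbf r,j}-\lambda_{\mathbf r,j}}\frac{\sigma_{\mathbf r,j,l}(z_j)}{u_j^{l+1}}+\sum_{l=0}^{\lambda_{\mathbf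 r,j}-1}\frac{\tau_{\mathbf r,j,l}(z_j)}{u_j-\phi_{\mathbf r,j,l}(z_j)}\right)\\&=\sum_{(\boldsymbol\ell,\nu)\in\mathcal L(\mathbf r)}\frac{\eta_{\mathbf r,\boldsymbol\ell,\nu}(\mathbf z)}{(\mathbf u-\boldsymbol\varphi_{\mathbf r,\boldsymbol\ell,\nu}(\mathbf z))^{\boldsymbol\ell+\mathbf 1}},\end{aligned}$$ where $\phi_{\mathbf r,j,l}(z_j):=z_j^{m_j/\lambda_{\mathbf r,j}}e^{i2\pi l/\lambda_{\mathbf r,j}}=z_j^{m_j/\lambda_{\mathbf r,j}}\zeta_{\mathbf r,j}^l$ and $\zeta_{\mathbf r,j}:=e^{i2\pi/\lambda_{\mathbf r,j}}$, for all $\mathbf r\in\mathcal R(\mathbf m)$, $j\in\{1,\dots,d\}$, $l\in\{0,\dots,\lambda_{\mathbf r,j}-1\}$. The first and second equalities follow from the one-variable partial fraction decomposition of each factor with respect to $u_j$; the $\phi_{\mathbf r,j,l}(z_j)$ are well defined because $\lambda_{\mathbf r,j}\ne0$. (S2.b) Moreover, the vector generating functions $\mathbf f_k$ satisfy the contour-integral recursion $$\mathbf f_k(\mathbf z)=\sum_{\mathbf r\in\mathcal R(\mathbf m)}\frac{\mathbf z^{\mathbf r}}{(2\pi i)^d}\oint_{\mathcal C(\boldsymbol\rho)}\left(\prod_{j=1}^d\frac{1}{u_j^{\mu_{\mathbf r,j}-\lambda_{\mathbf r,j}+1}(u_j^{\lambda_{\mathbf r,j}}-z_j^{m_j})}\right)\mathbf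 f_{k-1}(\mathbf u)\,d\mathbf u,$$ for any poly-radius $\boldsymbol\rho\in\mathbb R_+^d$ such that $|z_j|^{m_j/\lambda_j^{\max}}<\rho_j<1$, where $\lambda_j^{\max}:=\max\{\lambda_{\mathbf r,j}:\mathbf r\in\mathcal R(\mathbf m)\}$, for all $j\in\{1,\dots,d\}$, as well as the functional recurrence $$\mathbf f_k(\mathbf z)=\sum_{\mathbf r\in\mathcal R(\mathbf m)}\mathbf z^{\mathbf r}\sum_{(\boldsymbol\ell,\nu)\in\mathcal L(\mathbf r)}\frac{\eta_{\mathbf r,\boldsymbol\ell,\nu}(\mathbf z)}{\boldsymbol\ell!}\,\mathbf f_{k-1}^{(\boldsymbol\ell)}(\boldsymbol\varphi_{\mathbf r,\boldsymbol\ell,\nu}(\mathbf z)),$$ for all $\mathbf z\in\mathbb D_*^d$ and $k\in\mathbb N$. The initial condition is $\mathbf f_0(\mathbf z)=[f_{1,0}(\mathbf z),\dots,f_{d,0}(\mathbf z)]^\top$, where $f_{j,0}(\mathbf z)=\dfrac{z_j}{(1-z_j)^2\prod_{l\ne j}(1-z_l)}$ for all $j\in\{1,\dots,d\}$. (S2.c) Finally, the vector generating function $\mathbf F$ satisfies the functional equation $$\mathbf F(\mathbf z,w)=\mathbf f_0(\mathbf z)+w\sum_{\mathbf r\in\mathcal R(\mathbf m)}\mathbf z^{\mathbf r}\sum_{(\boldsymbol\ell,\nu)\in\mathcal L(\mathbf r)}\frac{\eta_{\mathbf r,\boldsymbol\ell,\nu}(\mathbf z)}{\boldsymbol\ell!}\,\mathbf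 F_*^{(\boldsymbol\ell)}(\boldsymbol\varphi_{\mathbf r,\boldsymbol\ell,\nu}(\mathbf z),w),$$ for all $(\mathbf z,w)\in\mathbb D_*^d\times\mathcal D(R_w)$, where $\mathbf F_*^{(\boldsymbol\ell)}(\mathbf v,w):=\left.\frac{\partial^{\ell_1+\cdots+\ell_d}\mathbf F(\mathbf z,w)}{\partial z_1^{\ell_1}\cdots\partial z_d^{\ell_d}}\right|_{\mathbf z=\mathbf v}$.
   Context: Notation: $\mathbb N=\{1,2,\dots\}$, $\mathbb N_0=\mathbb N\cup\{0\}$, $\mathbb R_+=(0,\infty)$, $\mathbb D=\{z\in\mathbb C:|z|<1\}$, $\mathbb D_*=\mathbb D\setminus\{0\}$, $\mathcal D(R)=\{w\in\mathbb C:|w|<R\}$. $\mathbf 0,\mathbf 1$ are the zero and all-ones vectors. Empty sums are $0$, empty products are $1$, $0^0=1$, $0!=1$. $\mathcal R(\mathbf m)=\prod_{j=1}^d\{0,\dots,m_j-1\}$; $\mathbf n\equiv\mathbf r\pmod{\mathbf m}$ means $n_j\equiv r_j\pmod{m_j}$ for all $j$; $\mathbf z^{\mathbf n}=\prod_jz_j^{n_j}$; $\mathbf n!=\prod_jn_j!$; $\mathbf f^{(\boldsymbol\ell)}$ is the componentwise partial derivative $\partial^{\ell_1+\cdots+\ell_d}\mathbf f/\partial z_1^{\ell_1}\cdots\partial z_d^{\ell_d}$. $\|\cdot\|_{\max}$ is the maximum of the absolute values of all entries (of a vector, a matrix, or a finite family of matrices). $\mathcal C(\boldsymbol\rho)=\{\mathbf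 u\in\mathbb C^d:|u_j|=\rho_j,\ j=1,\dots,d\}$, and $\oint_{\mathcal C(\boldsymbol\rho)}\cdots d\mathbf u$ is the multiple contour integral over the counterclockwise circles $|u_j|=\rho_j$, taken componentwise for vector functions. Collatz dynamics: Let $d\in\mathbb N$, $\mathbf m\in\mathbb N^d$, $\mathbf A_\circ=[\mathbf A_{\mathbf r}]_{\mathbf r\in\mathcal R(\mathbf m)}$ and $\mathbf B=[\mathbf b_{\mathbf r}]_{\mathbf r\in\mathcal R(\mathbf m)}$, where the $\mathbf A_{\mathbf r}$ are $d\times d$ matrices and the $\mathbf b_{\mathbf r}$ are $d$-dimensional vectors. The $(\mathbf m,\mathbf A_\circ,\mathbf B)$-Collatz map $\mathbf t:\mathbb N_0^d\to\mathbb N_0^d$ is defined by $\mathbf t(\mathbf n):=\mathbf A_{\mathbf r}\mathbf n+\mathbf b_{\mathbf r}$ if $\mathbf r\in\mathcal R(\mathbf m)$ and $\mathbf n\equiv\mathbf r\pmod{\mathbf m}$, whenever the following conditions hold for all $\mathbf r\in\mathcal R(\mathbf m)$: (C2.a) $\boldsymbol\lambda_{\mathbf r}=[\lambda_{\mathbf r,1},\dots,\lambda_{\mathbf r,d}]^\top:=\mathbf A_{\mathbf r}\mathbf m\in\mathbb N^d$, and (C2.b) $\boldsymbol\mu_{\mathbf r}=[\mu_{\mathbf r,1},\dots,\mu_{\mathbf r,d}]^\top:=\mathbf A_{\mathbf r}\mathbf r+\mathbf b_{\mathbf r}\in\mathbb N_0^d$. The induced $(\mathbf m,\mathbf A_\circ,\mathbf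 B)$-Collatz dynamics is given by the iterates $\mathbf t_0(\mathbf n):=\mathbf n$, $\mathbf t_k(\mathbf n):=\mathbf t(\mathbf t_{k-1}(\mathbf n))=\mathbf t_{k-1}(\mathbf t(\mathbf n))$ for $k\in\mathbb N$. Generating functions: Let $R_w:=\min\{(d\|\mathbf A_\circ\|_{\max})^{-1},1\}>0$. Define $\mathbf f_k:\mathbb D^d\to\mathbb C^d$ by $\mathbf f_k(\mathbf z):=\sum_{\mathbf n\in\mathbb N_0^d}\mathbf t_k(\mathbf n)\,\mathbf z^{\mathbf n}$ for $k\in\mathbb N_0$, and $\mathbf F:\mathbb D^d\times\mathcal D(R_w)\to\mathbb C^d$ by $\mathbf F(\mathbf z,w):=\sum_{k\in\mathbb N_0}\sum_{\mathbf n\in\mathbb N_0^d}\mathbf t_k(\mathbf n)\,\mathbf z^{\mathbf n}w^k=\sum_{k\in\mathbb N_0}\mathbf f_k(\mathbf z)w^k$; these series converge and the functions are continuous and holomorphic on these domains. For $z_j\ne0$, $\{\phi_{\mathbf r,j,0}(z_j),\dots,\phi_{\mathbf r,j,\lambda_{\mathbf r,j}-1}(z_j)\}$ is the set of all complex solutions $u$ of $u^{\lambda_{\mathbf r,j}}=z_j^{m_j}$. The last sum in (S2.a) comes from multiplying out the preceding product; the auxiliary index $\nu$ distinguishes terms having the same multi-index $\boldsymbol\ell$. The $\mathcal L(\mathbf r)$, $\eta_{\mathbf r,\boldsymbol\ell,\nu}$, $\boldsymbol\varphi_{\mathbf r,\boldsymbol\ell,\nu}$ in (S2.b) and (S2.c)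 are those of (S2.a).
   Formalization: The recursions in (S2.b) and the functional equation (S2.c) are stated only when every matrix A_r is diagonal; otherwise they fail (d=2, m=(1,1), A_0 swapping coordinates, b_0=0 would give f_1=f_0). (S2.a) and the initial condition hold for all A_r. *)

theory Defs
  imports "HOL-Complex_Analysis.Contour_Integration" "HOL-Number_Theory.Cong"
begin

text \<open>Coordinates are indexed by a finite type \<open>'d\<close>, so that \<open>d = CARD('d)\<close>; multi-indices are
  vectors of type \<open>nat ^ 'd\<close>.\<close>

definition cvec :: "nat ^ 'd::finite \<Rightarrow> complex ^ 'd" where
  "cvec n = (\<chi> j. of_nat (n $ j))"

definition mpow :: "'a::comm_monoid_mult ^ 'd::finite \<Rightarrow> nat ^ 'd \<Rightarrow> 'a" where
  "mpow z n = (\<Prod>j\<in>UNIV. (z $ j) ^ (n $ j))"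

definition mfact :: "nat ^ 'd::finite \<Rightarrow> complex" where
  "mfact l = (\<Prod>j\<in>UNIV. fact (l $ j))"

definition polydisc :: "(complex ^ 'd::finite) set" where
  "polydisc = {z. \<forall>j. norm (z $ j) < 1}"

definition punctured_polydisc :: "(complex ^ 'd::finite) set" where
  "punctured_polydisc = {z. \<forall>j. 0 < norm (z $ j) \<and> norm (z $ j) < 1}"

definition residue_box :: "nat ^ 'd::finite \<Rightarrow> (nat ^ 'd) set" where
  "residue_box m = {r. \<forall>j. r $ j < m $ j}"

text \<open>Families indexed by \<^term>\<open>residue_box m\<close> are total functions on multi-indices of which only the
  values on \<^term>\<open>residue_box m\<close> are used.\<close>

definition is_collatz_map ::
  "nat ^ 'd::finite \<Rightarrow> (nat ^ 'd \<Rightarrow> complex ^ 'd ^ 'd) \<Rightarrow> (nat ^ 'd \<Rightarrow> complex ^ 'd)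
    \<Rightarrow> (nat ^ 'd \<Rightarrow> nat ^ 'd) \<Rightarrow> bool" where
  "is_collatz_map m A b t \<longleftrightarrow>
    (\<forall>r\<in>residue_box m. \<forall>n. (\<forall>j. [n $ j = r $ j] (mod m $ j)) \<longrightarrow>
       cvec (t n) = A r *v cvec n + b r)"

definition family_max_norm ::
  "nat ^ 'd::finite \<Rightarrow> (nat ^ 'd \<Rightarrow> complex ^ 'd ^ 'd) \<Rightarrow> real" where
  "family_max_norm m A = Max {norm (A r $ i $ j) |r i j. r \<in> residue_box m}"

definition R_w :: "nat ^ 'd::finite \<Rightarrow> (nat ^ 'd \<Rightarrow> complex ^ 'd ^ 'd) \<Rightarrow> real" where
  "R_w m A = min (inverse (of_nat CARD('d) * family_max_norm m A)) 1"

definition gen_f :: "(nat ^ 'd::finite \<Rightarrow> nat ^ 'd) \<Rightarrow> nat \<Rightarrow> complex ^ 'd \<Rightarrow> complex ^ 'd" where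
  "gen_f t k z = (\<Sum>\<^sub>\<infinity>n\<in>UNIV. mpow z n *s cvec ((t ^^ k) n))"

definition gen_F :: "(nat ^ 'd::finite \<Rightarrow> nat ^ 'd) \<Rightarrow> complex ^ 'd \<Rightarrow> complex \<Rightarrow> complex ^ 'd" where
  "gen_F t z w = (\<Sum>\<^sub>\<infinity>k\<in>UNIV. \<Sum>\<^sub>\<infinity>n\<in>UNIV. (mpow z n * w ^ k) *s cvec ((t ^^ k) n))"

definition partial_deriv ::
  "'d::finite \<Rightarrow> (complex ^ 'd \<Rightarrow> complex ^ 'd) \<Rightarrow> complex ^ 'd \<Rightarrow> complex ^ 'd" where
  "partial_deriv j f z =
    (\<chi> i. deriv (\<lambda>x. f (\<chi> k. if k = j then x else z $ k) $ i) (z $ j))"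

text \<open>The index type carries no order, so the partial derivatives are taken in the order of some
  enumeration of the coordinates; the order is irrelevant for holomorphic functions.\<close>

definition mixed_deriv ::
  "nat ^ 'd::finite \<Rightarrow> (complex ^ 'd \<Rightarrow> complex ^ 'd) \<Rightarrow> complex ^ 'd \<Rightarrow> complex ^ 'd" where
  "mixed_deriv l f =
    foldr (\<lambda>j. partial_deriv j ^^ (l $ j)) (SOME js. distinct js \<and> set js = UNIV) f"

text \<open>The multiple contour integral over the torus \<open>|u\<^sub>j| = \<rho>\<^sub>j\<close>, written out through the
  parametrisation of the circles in the same way as the one-variable contour integral of the
  library.\<close>

definition torus_integral ::
  "real ^ 'd::finite \<Rightarrow> (complex ^ 'd \<Rightarrow> complex ^ 'd) \<Rightarrow> complex ^ 'd" where
  "torus_integral \<rho> g =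
    integral (cbox 0 1) (\<lambda>x.
      (\<Prod>j\<in>UNIV. vector_derivative (circlepath 0 (\<rho> $ j)) (at (x $ j))) *s
      g (\<chi> j. circlepath 0 (\<rho> $ j) (x $ j)))"

text \<open>In the next definitions \<open>m\<close>, \<open>lam\<close>, \<open>mu\<close> are the one-coordinate quantities \<open>m\<^sub>j\<close>,
  \<open>\<lambda>\<^sub>r\<^sub>,\<^sub>j\<close>, \<open>\<mu>\<^sub>r\<^sub>,\<^sub>j\<close>. The power of \<open>z\<close> is the principal one.\<close>

definition root_phi :: "nat \<Rightarrow> nat \<Rightarrow> nat \<Rightarrow> complex \<Rightarrow> complex" where
  "root_phi m lam l z = z powr (of_nat m / of_nat lam) * exp (\<i> * 2 * pi * of_nat l / of_nat lam)"

lemma root_phi_eq: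
  "root_phi m lam l z = z powr (of_nat m / of_nat lam) * exp (\<i> * 2 * pi / of_nat lam) ^ l"
  by (simp add: root_phi_def mult_ac flip: exp_of_nat_mult)

definition pf_kernel :: "nat \<Rightarrow> nat \<Rightarrow> nat \<Rightarrow> complex \<Rightarrow> complex \<Rightarrow> complex" where
  "pf_kernel m lam mu z u = 1 / (u powi (int mu - int lam + 1) * (u ^ lam - z ^ m))"

text \<open>The sum over \<open>0 \<le> l \<le> mu - lam\<close> is indexed by \<open>l < Suc mu - lam\<close>; the truncated subtraction
  makes it empty exactly when \<open>mu < lam\<close>.\<close>

definition pf_sum ::
  "nat \<Rightarrow> nat \<Rightarrow> nat \<Rightarrow> (nat \<Rightarrow> complex) \<Rightarrow> (nat \<Rightarrow> complex) \<Rightarrow> complex \<Rightarrow> complex \<Rightarrow> complex" where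
  "pf_sum m lam mu \<sigma> \<tau> z u =
    (\<Sum>l<Suc mu - lam. \<sigma> l / u ^ (l + 1)) + (\<Sum>l<lam. \<tau> l / (u - root_phi m lam l z))"

definition is_partial_fraction ::
  "nat \<Rightarrow> nat \<Rightarrow> nat \<Rightarrow> complex \<Rightarrow> (nat \<Rightarrow> complex) \<Rightarrow> (nat \<Rightarrow> complex) \<Rightarrow> bool" where
  "is_partial_fraction m lam mu z \<sigma> \<tau> \<longleftrightarrow>
    (\<forall>u. u \<noteq> 0 \<longrightarrow> u ^ lam \<noteq> z ^ m \<longrightarrow> pf_kernel m lam mu z u = pf_sum m lam mu \<sigma> \<tau> z u)"

text \<open>Multiplying out \<open>\<Prod>\<^sub>j pf_sum \<dots>\<close>: a term of the product is a choice of one summand in every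
  factor, where \<open>Inl l\<close> stands for \<open>\<sigma>\<^sub>l / u\<^sup>l\<^sup>+\<^sup>1\<close> and \<open>Inr l\<close> for \<open>\<tau>\<^sub>l / (u - \<phi>\<^sub>l)\<close>.\<close>

definition term_choices :: "nat ^ 'd::finite \<Rightarrow> nat ^ 'd \<Rightarrow> ('d \<Rightarrow> nat + nat) set" where
  "term_choices lam mu =
    {c. \<forall>j. case c j of Inl l \<Rightarrow> l < Suc (mu $ j) - lam $ j | Inr l \<Rightarrow> l < lam $ j}"

text \<open>The family indexed by pairs \<open>(\<ell>, \<nu>) \<in> L\<close> enumerates the terms of the multiplied-out product,
  each of them having the form \<open>\<eta> / (u - \<phi>)\<^bsup>\<ell>+1\<^esup>\<close>; \<open>\<nu>\<close> only tells apart terms with equal \<open>\<ell>\<close>.\<close>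

definition multiplies_out ::
  "nat ^ 'd::finite \<Rightarrow> nat ^ 'd \<Rightarrow> nat ^ 'd
    \<Rightarrow> ('d \<Rightarrow> nat \<Rightarrow> complex \<Rightarrow> complex) \<Rightarrow> ('d \<Rightarrow> nat \<Rightarrow> complex \<Rightarrow> complex)
    \<Rightarrow> ((nat ^ 'd) \<times> nat) set \<Rightarrow> ((nat ^ 'd) \<times> nat \<Rightarrow> complex ^ 'd \<Rightarrow> complex)
    \<Rightarrow> ((nat ^ 'd) \<times> nat \<Rightarrow> complex ^ 'd \<Rightarrow> complex ^ 'd) \<Rightarrow> bool" where
  "multiplies_out m lam mu \<sigma> \<tau> L \<eta> \<phi> \<longleftrightarrow>
    (\<exists>e. bij_betw e (term_choices lam mu) L \<and>
      (\<forall>c\<in>term_choices lam mu.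
        fst (e c) = (\<chi> j. case c j of Inl l \<Rightarrow> l | Inr l \<Rightarrow> 0) \<and>
        (\<forall>z\<in>punctured_polydisc.
          \<eta> (e c) z = (\<Prod>j\<in>UNIV. case c j of Inl l \<Rightarrow> \<sigma> j l (z $ j) | Inr l \<Rightarrow> \<tau> j l (z $ j)) \<and>
          \<phi> (e c) z = (\<chi> j. case c j of Inl l \<Rightarrow> 0 | Inr l \<Rightarrow> root_phi (m $ j) (lam $ j) l (z $ j)))))"

end

theory Submission
  imports Defs "HOL-Complex_Analysis.Cauchy_Integral_Formula"
begin

text \<open>On a residue class \<open>n = r + m q\<close> the map is affine, \<open>t n = \<mu>\<^sub>r + \<lambda>\<^sub>r q\<close>, so that
  \<open>\<Sum>\<^sub>n c (t n) z\<^sup>n = \<Sum>\<^sub>r z\<^sup>r \<Sum>\<^sub>q c (\<mu>\<^sub>r + \<lambda>\<^sub>r q) z\<^bsup>m q\<^esup>\<close> for every coefficient family \<open>c\<close>. The inner sum is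
  \<open>\<Sum>\<^sub>n c n \<kappa> n\<close>, where \<open>\<kappa> n\<close> is the coefficient of \<open>u\<^bsup>-n-1\<^esup>\<close> in the expansion at infinity of the product of the
  kernels \<open>1 / (u\<^bsup>\<mu>-\<lambda>+1\<^esup> (u\<^sup>\<lambda> - z\<^sup>m))\<close>. Every linear functional of a power series that sends the
  monomial \<open>u\<^sup>n\<close> to \<open>\<kappa> n\<close> therefore gives a form of the recursion. The torus integral against the kernel is one
  such functional, by Cauchy's formula in each variable; the sum of derivatives
  \<open>\<eta> / \<ell>! f\<^bsup>(\<ell>)\<^esup>(\<phi>)\<close> is another, by the partial fraction decomposition. Applied to the coefficients of
  \<open>f\<^bsub>k-1\<^esub>\<close> this yields (S2.b); applied to \<open>\<Sum>\<^sub>k t\<^sub>k n w\<^sup>k\<close> it yields (S2.c).\<close>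

subsection \<open>Roots of unity and the one-variable partial fraction decomposition\<close>

text \<open>The affine form on a residue class is where diagonality enters: \<open>A r\<close> maps
  \<open>m * q\<close> to \<open>lam r * q\<close> for every \<open>q\<close> only if
  \<open>A r\<close> is diagonal, since \<open>lam r\<close> records nothing but the row sums of
  \<open>A r\<close> weighted by \<open>m\<close>. For k = 1 the coefficients on the right-hand side
  are \<open>mu r + lam r * q\<close> whatever the matrices are, so comparing coefficients already
  forces diagonal matrices. Each recursion is an equality of two sums of one series: both sides are
  shown to satisfy \<open>has_sum\<close> for the same terms, and uniqueness of the sum concludes.
  The function F fits this scheme because for fixed w it is again a power series in z. Its
  definition sums over n before k, while its coefficients need the sum over k inside; linear growth
  of the orbits and the radius \<open>R_w\<close> give the absolute convergence that permits the
  exchange.\<close>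

definition unity_root :: "nat \<Rightarrow> complex" where
  "unity_root n = exp (\<i> * 2 * pi / of_nat n)"

lemma unity_root_powi_eq_1_iff:
  assumes "n > 0"
  shows "unity_root n powi p = 1 \<longleftrightarrow> int n dvd p"
proof -
  have "unity_root n powi p = exp (of_int p * (\<i> * 2 * pi / of_nat n))"
    unfolding unity_root_def by (simp add: exp_power_int)
  also have "\<dots> = 1 \<longleftrightarrow> (\<exists>k::int. real_of_int p * 2 * pi / real n = of_int (2 * k) * pi)"
    by (simp add: exp_eq_1 Im_divide_of_nat mult_ac)
  also have "\<dots> \<longleftrightarrow> (\<exists>k::int. real_of_int p = real_of_int (int n * k))"
    using assms by (simp add: field_simps)
  also have "\<dots> \<longleftrightarrow> int n dvd p"
    by (simp only: of_int_eq_iff dvd_def)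
  finally show ?thesis .
qed

text \<open>Orthogonality of the characters of Z/n: a geometric sum whose ratio is 1 exactly when n
  divides p. The exponent is an integer because the residues of the kernel contribute negative
  powers of the roots.\<close>

lemma sum_unity_root_powi:
  assumes "n > 0"
  shows "(\<Sum>l<n. (unity_root n ^ l) powi p) = (if int n dvd p then of_nat n else 0)"
proof -
  let ?x = "unity_root n powi p"
  have [simp]: "unity_root n \<noteq> 0"
    by (simp add: unity_root_def)
  have eq: "(\<Sum>l<n. (unity_root n ^ l) powi p) = (\<Sum>l<n. ?x ^ l)"
    by (intro sum.cong refl) (simp add: mult.commute flip: power_int_of_nat power_int_mult)
  show ?thesis
  proof (cases "int n dvd p")
    case True
    then show ?thesis
      unfolding eq using unity_root_powi_eq_1_iff[OF assms, of p] by simp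
  next
    case False
    then have "?x \<noteq> 1"
      using unity_root_powi_eq_1_iff[OF assms] by simp
    moreover have "?x ^ n = unity_root n powi (p * int n)"
      by (simp flip: power_int_of_nat power_int_mult)
    then have "?x ^ n = 1"
      using unity_root_powi_eq_1_iff[OF assms] by simp
    ultimately show ?thesis
      unfolding eq using False by (simp add: geometric_sum)
  qed
qed

lemma root_phi_unity_root:
  "root_phi m lam l z = z powr (of_nat m / of_nat lam) * unity_root lam ^ l"
  by (simp add: root_phi_eq unity_root_def)

lemma powr_quotient_power:
  assumes "z \<noteq> 0" "lam > 0"
  shows "(z powr (of_nat m / of_nat lam) :: complex) ^ lam = z ^ m"
proof -
  have "(z powr (of_nat m / of_nat lam)) ^ lam = exp (of_nat lam * (of_nat m / of_nat lam * Ln z))"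
    using assms by (simp only: powr_def exp_of_nat_mult) simp
  also have "of_nat lam * (of_nat m / of_nat lam * Ln z) = of_nat m * Ln z"
    using assms by simp
  also have "exp \<dots> = z ^ m"
    using assms by (simp add: exp_of_nat_mult)
  finally show ?thesis .
qed

lemma root_phi_nonzero [simp]: "z \<noteq> 0 \<Longrightarrow> root_phi m lam l z \<noteq> 0"
  by (simp add: root_phi_def)

lemma root_phi_power:
  assumes "z \<noteq> 0" "lam > 0"
  shows "root_phi m lam l z ^ lam = z ^ m"
proof -
  have "(unity_root lam ^ l) ^ lam = unity_root lam powi (int l * int lam)"
    by (metis of_nat_mult power_int_of_nat power_mult)
  also have "\<dots> = 1"
    using unity_root_powi_eq_1_iff[OF assms(2)] by simp
  finally show ?thesis
    using powr_quotient_power[OF assms, of m] by (simp add: root_phi_unity_root power_mult_distrib)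
qed

lemma norm_root_phi:
  assumes "z \<noteq> 0"
  shows "norm (root_phi m lam l z) = norm z powr (real m / real lam)"
proof -
  have "of_nat m / of_nat lam = complex_of_real (real m / real lam)"
    by simp
  then have "norm (z powr (of_nat m / of_nat lam)) = norm z powr (real m / real lam)"
    using norm_powr_real_powr'[of "of_nat m / of_nat lam" z] by simp
  moreover have "norm (exp (\<i> * 2 * pi * of_nat l / of_nat lam)) = 1"
    by (simp add: norm_exp_eq_Re Re_divide_of_nat)
  ultimately show ?thesis
    by (simp add: root_phi_def norm_mult)
qed

lemma inj_on_root_phi:
  assumes "z \<noteq> 0" "lam > 0"
  shows "inj_on (\<lambda>l. root_phi m lam l z) {..<lam}"
proof (rule inj_onI)
  fix a b assume ab: "a \<in> {..<lam}" "b \<in> {..<lam}" "root_phi m lam a z = root_phi m lam b z"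
  have [simp]: "unity_root lam \<noteq> 0"
    by (simp add: unity_root_def)
  have "unity_root lam powi (int a - int b) = 1"
    using ab assms by (simp add: root_phi_unity_root power_int_diff)
  then have "int lam dvd int a - int b"
    using unity_root_powi_eq_1_iff assms by blast
  moreover have "\<bar>int a - int b\<bar> < int lam"
    using ab by auto
  ultimately show "a = b"
    using dvd_imp_le_int[of "int a - int b" "int lam"] by force
qed

text \<open>Both sides are monic of degree \<open>lam\<close> in u and agree at the
  \<open>lam\<close> distinct points phi_l; with equal leading coefficients that many points
  suffice.\<close>

lemma prod_root_phi:
  assumes "z \<noteq> 0" "lam > 0"
  shows "(\<Prod>l<lam. u - root_phi m lam l z) = u ^ lam - z ^ m"
proof -
  let ?p = "\<Prod>l<lam. [:- root_phi m lam l z, 1:]" and ?q = "monom 1 lam - [:z ^ m:]"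
  have deg: "degree ?p = lam"
    by (subst degree_prod_eq_sum_degree) auto
  have "?p = ?q"
  proof (rule poly_eqI_degree_lead_coeff[where n = lam and A = "(\<lambda>l. root_phi m lam l z) ` {..<lam}"])
    have "lead_coeff ?p = 1"
      by (simp add: lead_coeff_prod)
    then show "poly.coeff ?p lam = poly.coeff ?q lam"
      using assms deg by (simp add: coeff_pCons split: nat.split)
    show "lam \<le> card ((\<lambda>l. root_phi m lam l z) ` {..<lam})"
      using inj_on_root_phi[OF assms] by (simp add: card_image)
    show "degree ?p \<le> lam"
      using deg by simp
    show "degree ?q \<le> lam"
      by (intro degree_diff_le) (auto simp: degree_monom_le)
    show "poly ?p x = poly ?q x" if "x \<in> (\<lambda>l. root_phi m lam l z) ` {..<lam}" for x
      using that root_phi_power[OF assms, of m] by (auto simp: poly_prod poly_monom)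
  qed
  then have "poly ?p u = poly ?q u"
    by simp
  then show ?thesis
    by (simp add: poly_prod poly_monom)
qed

text \<open>The branch chosen by \<open>powr\<close> disappears: orthogonality removes the exponents
  not divisible by \<open>lam\<close>, and for the others the power of the principal root is an
  integer power of \<open>z ^ m\<close>.\<close>

lemma sum_root_phi_powi:
  assumes "z \<noteq> 0" "lam > 0"
  shows "(\<Sum>l<lam. root_phi m lam l z powi p) =
           (if int lam dvd p then of_nat lam * (z ^ m) powi (p div int lam) else 0)"
proof -
  let ?w = "z powr (of_nat m / of_nat lam)"
  have "(\<Sum>l<lam. root_phi m lam l z powi p) = ?w powi p * (\<Sum>l<lam. (unity_root lam ^ l) powi p)"
    by (simp add: root_phi_unity_root power_int_mult_distrib sum_distrib_left)
  moreover have "?w powi p = (z ^ m) powi (p div int lam)" if "int lam dvd p"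
  proof -
    have "?w powi p = (?w powi int lam) powi (p div int lam)"
      using that by (metis dvd_mult_div_cancel power_int_mult)
    then show ?thesis
      using powr_quotient_power[OF assms] by simp
  qed
  ultimately show ?thesis
    using sum_unity_root_powi[OF assms(2)] by auto
qed

text \<open>\<open>pf_tau\<close> is the residue of the kernel at the simple pole \<open>\<phi>\<^sub>l\<close>. Comparing the expansions at infinity of
  the kernel and of its decomposition, the \<open>\<sigma>\<^sub>n\<close> have to cancel the contribution of the poles \<open>\<phi>\<^sub>l\<close> to
  \<open>u\<^bsup>-n-1\<^esup>\<close> for \<open>n < \<mu>\<close>; what is left is \<open>pf_moment\<close>.\<close>

definition pf_sigma :: "nat \<Rightarrow> nat \<Rightarrow> nat \<Rightarrow> complex \<Rightarrow> nat \<Rightarrow> complex" where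
  "pf_sigma m lam mu z l = (if l < mu \<and> int lam dvd int l - int mu
     then - ((z ^ m) powi ((int l - int mu) div int lam)) else 0)"

definition pf_tau :: "nat \<Rightarrow> nat \<Rightarrow> nat \<Rightarrow> complex \<Rightarrow> nat \<Rightarrow> complex" where
  "pf_tau m lam mu z l = root_phi m lam l z powi (- int mu) / of_nat lam"

definition pf_moment :: "nat \<Rightarrow> nat \<Rightarrow> nat \<Rightarrow> complex \<Rightarrow> nat \<Rightarrow> complex" where
  "pf_moment m lam mu z n = (if mu \<le> n \<and> lam dvd n - mu then (z ^ m) ^ ((n - mu) div lam) else 0)"

text \<open>The denominator of the kernel has derivative lam * phi_l^mu at phi_l, which accounts for
  the value of \<open>pf_tau\<close>; weighting with it shifts the exponent of the power sum by
  -mu.\<close>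

lemma sum_tau_power:
  assumes "z \<noteq> 0" "lam > 0"
  shows "(\<Sum>l<lam. pf_tau m lam mu z l * root_phi m lam l z ^ n) =
    (if int lam dvd int n - int mu then (z ^ m) powi ((int n - int mu) div int lam) else 0)"
proof -
  have "pf_tau m lam mu z l * root_phi m lam l z ^ n = root_phi m lam l z powi (int n - int mu) / of_nat lam" for l
    using assms by (simp add: pf_tau_def power_int_diff power_int_minus field_simps)
  then show ?thesis
    using sum_root_phi_powi[OF assms, of m "int n - int mu"] assms by (simp flip: sum_divide_distrib)
qed

text \<open>For n >= mu the index n lies beyond the range of the sigma, and the exponent in
  \<open>sum_tau_power\<close> is nonnegative. For n < mu divisibility by lam forces n <= mu - lam,
  so every nonzero contribution of the tau falls into the range of the sigma and is cancelled
  there.\<close>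

lemma partial_fraction_moment:
  assumes "z \<noteq> 0" "lam > 0"
  shows "(if n < Suc mu - lam then pf_sigma m lam mu z n else 0) +
         (\<Sum>l<lam. pf_tau m lam mu z l * root_phi m lam l z ^ n) = pf_moment m lam mu z n"
proof (cases "mu \<le> n")
  case True
  then have eq: "int n - int mu = int (n - mu)"
    by simp
  have "(z ^ m) powi (int (n - mu) div int lam) = (z ^ m) ^ ((n - mu) div lam)"
    by (simp only: zdiv_int[symmetric] power_int_of_nat)
  moreover have "\<not> n < Suc mu - lam"
    using True assms by simp
  ultimately show ?thesis
    using True unfolding sum_tau_power[OF assms] eq int_dvd_int_iff by (simp only: pf_moment_def) simp
next
  case False
  have "n < Suc mu - lam" if "int lam dvd int n - int mu"
  proof -
    have "int lam dvd int mu - int n"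
      using that by (simp add: dvd_diff_commute)
    then have "int lam \<le> int mu - int n"
      using False by (intro zdvd_imp_le) auto
    then show ?thesis by linarith
  qed
  with False show ?thesis
    unfolding sum_tau_power[OF assms] by (auto simp: pf_sigma_def pf_moment_def)
qed

text \<open>Multiplied by u^lam - z^m, each 1/(u - phi_l) becomes the sum of u^(lam-1-i) phi_l^i
  over i < lam. After exchanging the sums, \<open>sum_tau_power\<close> leaves only i = mu mod
  lam.\<close>

lemma sum_tau_quotient:
  assumes "z \<noteq> 0" "lam > 0" "u ^ lam \<noteq> z ^ m"
  shows "(\<Sum>l<lam. pf_tau m lam mu z l / (u - root_phi m lam l z)) =
     u ^ (lam - 1 - mu mod lam) / ((z ^ m) ^ (mu div lam) * (u ^ lam - z ^ m))"
proof -
  let ?Z = "z ^ m" and ?\<phi> = "\<lambda>l. root_phi m lam l z"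
  have ne: "u \<noteq> ?\<phi> l" for l
    using assms root_phi_power by blast
  have quot: "(u ^ lam - ?Z) / (u - ?\<phi> l) = (\<Sum>i<lam. u ^ (lam - Suc i) * ?\<phi> l ^ i)" for l
    using ne[of l] power_diff_sumr2[of u lam "?\<phi> l"] root_phi_power[OF assms(1,2), of m l]
    by (subst sum.nat_diff_reindex[symmetric]) (simp add: field_simps)
  have "(u ^ lam - ?Z) * (\<Sum>l<lam. pf_tau m lam mu z l / (u - ?\<phi> l)) =
      (\<Sum>l<lam. pf_tau m lam mu z l * ((u ^ lam - ?Z) / (u - ?\<phi> l)))"
    by (simp add: sum_distrib_left mult_ac)
  also have "\<dots> = (\<Sum>l<lam. pf_tau m lam mu z l * (\<Sum>i<lam. u ^ (lam - Suc i) * ?\<phi> l ^ i))"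
    by (simp only: quot)
  also have "\<dots> = (\<Sum>i<lam. u ^ (lam - Suc i) * (\<Sum>l<lam. pf_tau m lam mu z l * ?\<phi> l ^ i))"
    unfolding sum_distrib_left by (subst sum.swap) (simp add: mult_ac)
  also have "\<dots> = (\<Sum>i<lam. if i = mu mod lam then u ^ (lam - Suc i) * ?Z powi (- int (mu div lam)) else 0)"
  proof (intro sum.cong refl)
    fix i assume "i \<in> {..<lam}"
    then have "i = mu mod lam \<longleftrightarrow> int i mod int lam = int mu mod int lam"
      by (metis lessThan_iff mod_less of_nat_eq_iff zmod_int)
    then have iff: "i = mu mod lam \<longleftrightarrow> int lam dvd int i - int mu"
      by (simp add: mod_eq_dvd_iff)
    have "(int i - int mu) div int lam = - int (mu div lam)" if "i = mu mod lam"
    proof -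
      have "int i - int mu = int lam * (- int (mu div lam))"
        using that by (simp add: algebra_simps flip: of_nat_mult of_nat_add)
      then show ?thesis
        using assms(2) by (simp only: nonzero_mult_div_cancel_left of_nat_eq_0_iff)
    qed
    then show "u ^ (lam - Suc i) * (\<Sum>l<lam. pf_tau m lam mu z l * ?\<phi> l ^ i) =
        (if i = mu mod lam then u ^ (lam - Suc i) * ?Z powi (- int (mu div lam)) else 0)"
      unfolding sum_tau_power[OF assms(1,2)] using iff by auto
  qed
  also have "\<dots> = u ^ (lam - 1 - mu mod lam) / ?Z ^ (mu div lam)"
    using assms by (simp add: power_int_minus field_simps)
  finally show ?thesis
    using assms by (simp add: field_simps)
qed

text \<open>The nonzero sigma sit at l = mu - lam (p + 1) with p < mu div lam, and there 1/u^(l+1) =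
  u^(lam (p+1)) / u^(mu+1); the sum is therefore a finite geometric one in u^lam / z^m.\<close>

lemma sum_sigma_quotient:
  assumes "z \<noteq> 0" "lam > 0" "u \<noteq> 0"
  shows "(\<Sum>l<Suc mu - lam. pf_sigma m lam mu z l / u ^ (l + 1)) =
     - (\<Sum>p<mu div lam. (u ^ lam / z ^ m) ^ Suc p) / u ^ Suc mu"
proof -
  let ?h = "\<lambda>p. mu - lam * Suc p" and ?P = "mu div lam"
  have le: "lam * Suc p \<le> mu" if "p < ?P" for p
    using that by (metis Suc_leI div_times_less_eq_dividend dual_order.trans mult.commute mult_le_mono2)
  have inj: "inj_on ?h {..<?P}"
  proof (rule inj_onI)
    fix p q assume "p \<in> {..<?P}" "q \<in> {..<?P}" "?h p = ?h q"
    then have "lam * Suc p = lam * Suc q"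
      using le[of p] le[of q] unfolding lessThan_iff by linarith
    then show "p = q"
      using assms by simp
  qed
  have "(\<Sum>l<Suc mu - lam. pf_sigma m lam mu z l / u ^ (l + 1)) =
      (\<Sum>l\<in>?h ` {..<?P}. pf_sigma m lam mu z l / u ^ (l + 1))"
  proof (rule sum.mono_neutral_right)
    show "?h ` {..<?P} \<subseteq> {..<Suc mu - lam}"
      using le assms by fastforce
    show "\<forall>l\<in>{..<Suc mu - lam} - ?h ` {..<?P}. pf_sigma m lam mu z l / u ^ (l + 1) = 0"
    proof
      fix l assume l: "l \<in> {..<Suc mu - lam} - ?h ` {..<?P}"
      have False if "l < mu" "int lam dvd int l - int mu"
      proof -
        have "lam dvd mu - l"
          using that by (metis dvd_diff_commute int_dvd_int_iff less_imp_le of_nat_diff)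
        then obtain q where q: "mu - l = lam * q" ..
        then have "q > 0"
          using that by (cases q) auto
        then obtain p where p: "q = Suc p"
          using gr0_implies_Suc by blast
        have "lam * Suc p \<le> mu"
          using q p by (metis diff_le_self)
        then have "p < ?P"
          using assms by (simp add: less_eq_div_iff_mult_less_eq Suc_le_eq[symmetric] mult.commute)
        moreover have "l = ?h p"
          using q p that by (metis diff_diff_cancel less_imp_le)
        ultimately show False
          using l by auto
      qed
      then show "pf_sigma m lam mu z l / u ^ (l + 1) = 0"
        by (auto simp: pf_sigma_def)
    qed
  qed auto
  also have "\<dots> = (\<Sum>p<?P. pf_sigma m lam mu z (?h p) / u ^ (?h p + 1))"
    by (subst sum.reindex[OF inj]) simp
  also have "\<dots> = (\<Sum>p<?P. - ((u ^ lam / z ^ m) ^ Suc p / u ^ Suc mu))"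
  proof (intro sum.cong refl)
    fix p assume "p \<in> {..<?P}"
    then have p: "lam * Suc p \<le> mu"
      using le by simp
    then have eq: "int (?h p) - int mu = int lam * (- int (Suc p))"
      by (simp only: of_nat_diff of_nat_mult)
    have "?h p < mu"
      using p assms by (intro diff_less) auto
    then have "pf_sigma m lam mu z (?h p) = - ((z ^ m) powi (- int (Suc p)))"
      unfolding pf_sigma_def eq using assms by (simp del: mult_Suc_right)
    then have 1: "pf_sigma m lam mu z (?h p) = - inverse ((z ^ m) ^ Suc p)"
      by (simp only: power_int_minus power_int_of_nat)
    have "Suc mu = ?h p + 1 + lam * Suc p"
      using p by linarith
    then have 2: "u ^ Suc mu = u ^ (?h p + 1) * (u ^ lam) ^ Suc p"
      by (metis power_add power_mult)
    have "- inverse Z / a = - (L / Z / (a * L))" if "L \<noteq> 0" for Z L a :: complex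
      using that by (simp add: divide_inverse)
    then show "pf_sigma m lam mu z (?h p) / u ^ (?h p + 1) = - ((u ^ lam / z ^ m) ^ Suc p / u ^ Suc mu)"
      unfolding 1 2 power_divide using assms(3) by (metis power_not_zero)
  qed
  finally show ?thesis
    by (simp add: sum_negf sum_divide_distrib)
qed

text \<open>With X = u^lam / z^m and P = mu div lam, the tau part is u^lam X^P and the sigma part is
  -u^lam (X^P - 1), both over u^(mu+1) (u^lam - z^m). The terms in X^P cancel and the kernel
  remains.\<close>

lemma is_partial_fraction_sigma_tau:
  assumes "z \<noteq> 0" "lam > 0"
  shows "is_partial_fraction m lam mu z (pf_sigma m lam mu z) (pf_tau m lam mu z)"
  unfolding is_partial_fraction_def
proof (intro allI impI)
  fix u assume u: "u \<noteq> 0" "u ^ lam \<noteq> z ^ m"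
  let ?Z = "z ^ m" and ?P = "mu div lam"
  define X where "X = u ^ lam / ?Z"
  have X: "X \<noteq> 1" and Z: "?Z \<noteq> 0"
    using u assms by (auto simp: X_def)
  have "(\<Sum>p<?P. X ^ Suc p) = X * (X ^ ?P - 1) / (X - 1)"
    using X by (simp add: sum_distrib_left[symmetric] geometric_sum)
  also have "\<dots> = u ^ lam * (X ^ ?P - 1) / (u ^ lam - ?Z)"
    using Z u X by (simp add: X_def field_simps)
  finally have 1: "(\<Sum>p<?P. X ^ Suc p) = u ^ lam * (X ^ ?P - 1) / (u ^ lam - ?Z)" .
  have "mu mod lam < lam"
    using assms by simp
  then have "(lam - 1 - mu mod lam) + Suc mu = lam + lam * ?P"
    using mult_div_mod_eq[of lam mu] by linarith
  then have "u ^ (lam - 1 - mu mod lam) * u ^ Suc mu = u ^ lam * (u ^ lam) ^ ?P"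
    by (metis power_add power_mult)
  then have 2: "u ^ (lam - 1 - mu mod lam) / ?Z ^ ?P = u ^ lam * X ^ ?P / u ^ Suc mu"
    using u Z by (simp add: X_def power_divide field_simps del: power_Suc)
  have "pf_sum m lam mu (pf_sigma m lam mu z) (pf_tau m lam mu z) z u =
      (u ^ lam * X ^ ?P / u ^ Suc mu) / (u ^ lam - ?Z) - u ^ lam * (X ^ ?P - 1) / (u ^ lam - ?Z) / u ^ Suc mu"
    unfolding pf_sum_def sum_sigma_quotient[OF assms u(1)] sum_tau_quotient[OF assms u(2)] X_def[symmetric] 1 2[symmetric]
    by (simp add: mult.commute)
  also have "\<dots> = u ^ lam / (u ^ Suc mu * (u ^ lam - ?Z))"
  proof -
    have "a * X ^ ?P / e / d - a * (X ^ ?P - 1) / d / e = a / (e * d)" for a e d :: complex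
      by (simp add: diff_divide_distrib right_diff_distrib mult.commute)
    then show ?thesis .
  qed
  also have "\<dots> = pf_kernel m lam mu z u"
  proof -
    have "u powi (int mu - int lam + 1) = u ^ Suc mu / u ^ lam"
      using u power_int_diff[of u "int (Suc mu)" "int lam"]
      by (simp only: power_int_of_nat) (simp add: algebra_simps)
    then show ?thesis
      using u by (simp add: pf_kernel_def)
  qed
  finally show "pf_kernel m lam mu z u = pf_sum m lam mu (pf_sigma m lam mu z) (pf_tau m lam mu z) z u" ..
qed

section \<open>Uniqueness of the partial fraction coefficients\<close>

lemma power_eq_iff_root_phi:
  assumes "z \<noteq> 0" "lam > 0"
  shows "u ^ lam = z ^ m \<longleftrightarrow> (\<exists>l<lam. u = root_phi m lam l z)"
proof -
  have "u ^ lam = z ^ m \<longleftrightarrow> (\<Prod>l<lam. u - root_phi m lam l z) = 0"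
    unfolding prod_root_phi[OF assms] by simp
  then show ?thesis
    by auto
qed

lemma pf_sum_diff:
  "pf_sum m lam mu \<sigma>' \<tau>' z u - pf_sum m lam mu \<sigma> \<tau> z u =
     pf_sum m lam mu (\<lambda>l. \<sigma>' l - \<sigma> l) (\<lambda>l. \<tau>' l - \<tau> l) z u"
  by (simp add: pf_sum_def sum_subtractf diff_divide_distrib)

text \<open>Linear independence of the partial fractions. Multiplying by u - phi_k and letting u
  tend to phi_k isolates \<open>b k\<close>; once all \<open>b\<close> vanish, what remains is 1/u
  times a polynomial in 1/u with cofinitely many zeros.\<close>

lemma pf_sum_eq_0_imp:
  assumes z: "z \<noteq> 0" "lam > 0"
    and zero: "\<And>u. u \<noteq> 0 \<Longrightarrow> u ^ lam \<noteq> z ^ m \<Longrightarrow> pf_sum m lam mu a b z u = 0"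
  shows "\<forall>l<Suc mu - lam. a l = 0" "\<forall>l<lam. b l = 0"
proof -
  let ?\<phi> = "\<lambda>l. root_phi m lam l z"
  show b0: "\<forall>l<lam. b l = 0"
  proof (intro allI impI)
    fix k assume k: "k < lam"
    \<comment> \<open>All summands of \<open>pf_sum\<close> that are regular at phi_k.\<close>
    define h where "h = (\<lambda>u. (\<Sum>l<Suc mu - lam. a l / u ^ (l + 1)) + (\<Sum>l\<in>{..<lam} - {k}. b l / (u - ?\<phi> l)))"
    have ne: "?\<phi> l \<noteq> ?\<phi> k" if "l < lam" "l \<noteq> k" for l
      using inj_on_root_phi[OF z] that k by (auto simp: inj_on_def)
    have "isCont h (?\<phi> k)"
      unfolding h_def using z by (intro continuous_intros) (auto dest: ne[symmetric])
    then have "((\<lambda>u. (u - ?\<phi> k) * h u + b k) \<longlongrightarrow> (?\<phi> k - ?\<phi> k) * h (?\<phi> k) + b k) (at (?\<phi> k))"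
      unfolding isCont_def by (intro tendsto_intros)
    moreover have "\<forall>\<^sub>F u in at (?\<phi> k). (u - ?\<phi> k) * h u + b k = 0"
    proof -
      have "\<forall>\<^sub>F u in at (?\<phi> k). u \<notin> insert 0 (?\<phi> ` {..<lam})"
        using islimpt_finite[of "insert 0 (?\<phi> ` {..<lam})" "?\<phi> k"]
        by (simp add: islimpt_iff_eventually)
      then show ?thesis
      proof eventually_elim
        case (elim u)
        then have u: "u \<noteq> 0" "u ^ lam \<noteq> z ^ m" "u \<noteq> ?\<phi> k"
          using k power_eq_iff_root_phi[OF z] by auto
        have "pf_sum m lam mu a b z u = h u + b k / (u - ?\<phi> k)"
          using k by (simp add: pf_sum_def h_def sum.remove[of "{..<lam}" k])
        then show ?case
          using zero[OF u(1,2)] u(3) by (simp add: field_simps)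
      qed
    qed
    ultimately have "((\<lambda>u. 0) \<longlongrightarrow> (?\<phi> k - ?\<phi> k) * h (?\<phi> k) + b k) (at (?\<phi> k))"
      by (rule Lim_transform_eventually)
    then show "b k = 0"
      by (simp add: tendsto_const_iff)
  qed
  show "\<forall>l<Suc mu - lam. a l = 0"
  proof (intro allI impI, rule ccontr)
    fix k assume k: "k < Suc mu - lam" "a k \<noteq> 0"
    let ?N = "Suc mu - lam" and ?S = "- insert 0 (?\<phi> ` {..<lam})"
    have "(\<Sum>i\<le>?N - 1. a i * inverse u ^ i) = 0" if "u \<in> ?S" for u
    proof -
      have u: "u \<noteq> 0" "u ^ lam \<noteq> z ^ m"
        using that power_eq_iff_root_phi[OF z] by auto
      have "{..<?N} = {..?N - 1}"
        using k by auto
      moreover have "(\<Sum>l<?N. a l / u ^ (l + 1)) = inverse u * (\<Sum>i<?N. a i * inverse u ^ i)"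
        by (simp add: sum_distrib_left divide_inverse power_inverse mult_ac)
      moreover have "(\<Sum>l<?N. a l / u ^ (l + 1)) = 0"
        using zero[OF u] b0 by (simp add: pf_sum_def)
      ultimately show ?thesis
        using u by simp
    qed
    then have "inverse ` ?S \<subseteq> {x. (\<Sum>i\<le>?N - 1. a i * x ^ i) = 0}"
      by blast
    moreover have "finite {x. (\<Sum>i\<le>?N - 1. a i * x ^ i) = 0}"
      unfolding polyfun_finite_roots using k by (intro exI[of _ k]) auto
    ultimately have "finite (inverse ` ?S)"
      by (rule finite_subset)
    then have "finite ?S"
      by (rule finite_imageD) (simp add: inj_on_def)
    then have "finite (?S \<union> insert 0 (?\<phi> ` {..<lam}))"
      by simp
    moreover have "?S \<union> insert 0 (?\<phi> ` {..<lam}) = UNIV"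
      by blast
    ultimately have "finite (UNIV :: complex set)"
      by simp
    then show False
      using infinite_UNIV_char_0 by blast
  qed
qed

lemma partial_fraction_unique:
  assumes "z \<noteq> 0" "lam > 0"
    and "is_partial_fraction m lam mu z \<sigma> \<tau>" "is_partial_fraction m lam mu z \<sigma>' \<tau>'"
  shows "\<forall>l<Suc mu - lam. \<sigma>' l = \<sigma> l" "\<forall>l<lam. \<tau>' l = \<tau> l"
proof -
  have "pf_sum m lam mu (\<lambda>l. \<sigma>' l - \<sigma> l) (\<lambda>l. \<tau>' l - \<tau> l) z u = 0" if "u \<noteq> 0" "u ^ lam \<noteq> z ^ m" for u
    using assms(3,4) that by (simp add: is_partial_fraction_def flip: pf_sum_diff)
  from pf_sum_eq_0_imp[OF assms(1,2) this]
  show "\<forall>l<Suc mu - lam. \<sigma>' l = \<sigma> l" "\<forall>l<lam. \<tau>' l = \<tau> l"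
    by auto
qed

subsection \<open>Termwise differentiation of multivariate power series\<close>

text \<open>The \<open>l\<close>-th derivative of \<open>x\<^sup>n\<close>. For \<open>n < l\<close> the truncated exponent is harmless, because the binomial
  coefficient vanishes.\<close>

definition dmon :: "nat \<Rightarrow> nat \<Rightarrow> 'a::real_normed_field \<Rightarrow> 'a" where
  "dmon l n x = fact l * of_nat (n choose l) * x ^ (n - l)"

lemma dmon_0: "dmon 0 n x = x ^ n"
  by (simp add: dmon_def)

lemma dmon_at_0: "dmon l n 0 = (if n = l then fact l else 0)"
  by (auto simp: dmon_def power_0_left binomial_eq_0)

lemma norm_dmon: "norm (dmon l n x) = dmon l n (norm x)"
  by (simp add: dmon_def norm_mult norm_power)



lemma dmon_mono: "0 \<le> x \<Longrightarrow> x \<le> y \<Longrightarrow> dmon l n x \<le> dmon l n (y :: real)"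
  unfolding dmon_def by (intro mult_left_mono power_mono) auto

lemma has_field_derivative_dmon:
  "(dmon l n has_field_derivative dmon (Suc l) n x) (at x within S)"
proof -
  have "fact l * of_nat (n choose l) * of_nat (n - l) = (fact (Suc l) * of_nat (n choose Suc l) :: 'a)"
  proof -
    \<comment> \<open>For l >= n both sides vanish: \<open>n - l\<close> truncates to 0, and so does
      the binomial coefficient on the right.\<close>
    have "(n choose l) * (n - l) = Suc l * (n choose Suc l)"
    proof (cases "l < n")
      case True
      then obtain n' where "n = Suc n'"
        by (cases n) auto
      then show ?thesis
        using binomial_absorb_comp[of n l] Suc_times_binomial[of l n'] by (simp add: mult.commute)
    qed (simp add: binomial_eq_0)
    then have "of_nat (n choose l) * of_nat (n - l) = (of_nat (Suc l) * of_nat (n choose Suc l) :: 'a)"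
      by (metis of_nat_mult)
    then show ?thesis
      by (simp add: mult_ac)
  qed
  then have eq: "dmon (Suc l) n x = fact l * of_nat (n choose l) * (of_nat (n - l) * x ^ (n - l - 1))"
    by (simp add: dmon_def flip: mult.assoc)
  show ?thesis
    unfolding eq unfolding dmon_def [abs_def]
    by (rule derivative_eq_intros refl)+ simp
qed

definition dmpow :: "nat ^ 'd::finite \<Rightarrow> nat ^ 'd \<Rightarrow> 'a::real_normed_field ^ 'd \<Rightarrow> 'a" where
  "dmpow l n v = (\<Prod>k\<in>UNIV. dmon (l $ k) (n $ k) (v $ k))"

text \<open>The function \<open>f\<close> is the \<open>l\<close>-th derivative of the power series with coefficients \<open>c\<close>; for \<open>l = 0\<close> it is
  the power series itself.\<close>

definition power_series_deriv ::
  "('d::finite \<Rightarrow> nat ^ 'd \<Rightarrow> complex) \<Rightarrow> nat ^ 'd \<Rightarrow> (complex ^ 'd \<Rightarrow> complex ^ 'd) \<Rightarrow> bool" where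
  "power_series_deriv c l f \<longleftrightarrow>
     (\<forall>v\<in>polydisc. \<forall>i. ((\<lambda>n. c i n * dmpow l n v) has_sum f v $ i) UNIV)"



lemma dmpow_upd:
  "dmpow l n (\<chi> k. if k = j then x else v $ k) =
     dmon (l $ j) (n $ j) x * (\<Prod>k\<in>UNIV - {j}. dmon (l $ k) (n $ k) (v $ k))"
  unfolding dmpow_def by (subst prod.remove[of UNIV j]) (auto intro!: prod.cong)

lemma dmpow_Suc:
  "dmpow (l + axis j 1) n v =
     dmon (Suc (l $ j)) (n $ j) (v $ j) * (\<Prod>k\<in>UNIV - {j}. dmon (l $ k) (n $ k) (v $ k))"
  unfolding dmpow_def by (subst prod.remove[of UNIV j]) (auto intro!: prod.cong simp: axis_def)

text \<open>Weierstrass's theorem on uniform limits in the variable v_j, with the other coordinates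
  frozen into \<open>?C\<close> and the limit taken along the net of finite index sets. Only the
  series of \<open>f\<close> needs a majorant: its own terms at the real point R, where
  unconditional convergence is absolute.\<close>

lemma power_series_deriv_partial_deriv:
  fixes l :: "nat ^ 'd::finite"
  assumes f: "power_series_deriv c l f"
  shows "power_series_deriv c (l + axis j 1) (partial_deriv j f)"
  unfolding power_series_deriv_def
proof (intro ballI allI)
  fix v :: "complex ^ 'd" and i
  assume v: "v \<in> polydisc"
  let ?upd = "\<lambda>x. \<chi> k. if k = j then x else v $ k"
  let ?C = "\<lambda>n. c i n * (\<Prod>k\<in>UNIV - {j}. dmon (l $ k) (n $ k) (v $ k))"
  \<comment> \<open>Half the distance from |v_j| to 1, so that the closed disc of radius r about v_j
    stays within |x| <= R < 1.\<close>
  define r where "r = (1 - norm (v $ j)) / 2"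
  define R where "R = (1 + norm (v $ j)) / 2"
  have r: "r > 0" "R < 1" "R \<ge> 0" and rR: "norm (v $ j) + r = R"
    using v by (auto simp: polydisc_def r_def R_def field_simps)
  have le: "norm x \<le> R" if "x \<in> cball (v $ j) r" for x
    using that norm_triangle_ineq2[of x "v $ j"] by (simp add: dist_norm norm_minus_commute flip: rR)
  have in_poly: "?upd x \<in> polydisc" if "norm x \<le> R" for x
    using that v r by (auto simp: polydisc_def)
  have sum: "((\<lambda>n. ?C n * dmon (l $ j) (n $ j) x) has_sum f (?upd x) $ i) UNIV" if "norm x \<le> R" for x
    using f in_poly[OF that] unfolding power_series_deriv_def by (fastforce simp: dmpow_upd mult_ac)
  have "(\<lambda>n. ?C n * dmon (l $ j) (n $ j) (complex_of_real R)) summable_on UNIV"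
    using sum[of "complex_of_real R"] r has_sum_imp_summable by fastforce
  then have summ: "(\<lambda>n. norm (?C n * dmon (l $ j) (n $ j) (complex_of_real R))) summable_on UNIV"
    by (simp add: summable_on_iff_abs_summable_on_complex)
  have ulim: "uniform_limit (cball (v $ j) r) (\<lambda>X x. \<Sum>n\<in>X. ?C n * dmon (l $ j) (n $ j) x)
      (\<lambda>x. f (?upd x) $ i) (finite_subsets_at_top UNIV)"
  proof (rule Weierstrass_m_test_general'[OF _ _ summ])
    fix n x assume "x \<in> cball (v $ j) r"
    then have "norm x \<le> R"
      by (rule le)
    then show "norm (?C n * dmon (l $ j) (n $ j) x) \<le> norm (?C n * dmon (l $ j) (n $ j) (complex_of_real R))"
      unfolding norm_mult norm_dmon using r by (intro mult_left_mono dmon_mono) auto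
  qed (use sum le in auto)
  have der: "((\<lambda>x. \<Sum>n\<in>X. ?C n * dmon (l $ j) (n $ j) x) has_field_derivative
      (\<Sum>n\<in>X. ?C n * dmon (Suc (l $ j)) (n $ j) x)) (at x)" for X x
    by (intro DERIV_sum DERIV_cmult has_field_derivative_dmon)
  \<comment> \<open>The limit of the derivatives of the finite partial sums is again unconditional, so the
    differentiated series converges without a separate estimate.\<close>
  obtain g' where g': "\<And>x. x \<in> ball (v $ j) r \<Longrightarrow>
      ((\<lambda>x. f (?upd x) $ i) has_field_derivative g' x) (at x) \<and>
      ((\<lambda>X. \<Sum>n\<in>X. ?C n * dmon (Suc (l $ j)) (n $ j) x) \<longlongrightarrow> g' x) (finite_subsets_at_top UNIV)"
  proof (rule has_complex_derivative_uniform_limit[OF _ ulim _ r(1)])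
    show "\<forall>\<^sub>F X in finite_subsets_at_top UNIV.
        continuous_on (cball (v $ j) r) (\<lambda>x. \<Sum>n\<in>X. ?C n * dmon (l $ j) (n $ j) x) \<and>
        (\<forall>x\<in>ball (v $ j) r. ((\<lambda>x. \<Sum>n\<in>X. ?C n * dmon (l $ j) (n $ j) x) has_field_derivative
          (\<Sum>n\<in>X. ?C n * dmon (Suc (l $ j)) (n $ j) x)) (at x))"
      using der by (intro always_eventually allI conjI ballI DERIV_continuous_on[OF has_field_derivative_at_within]) auto
  qed (use that in auto)
  then have "partial_deriv j f v $ i = g' (v $ j)"
    using g'[of "v $ j"] r by (auto simp: partial_deriv_def intro: DERIV_imp_deriv)
  moreover have "((\<lambda>n. ?C n * dmon (Suc (l $ j)) (n $ j) (v $ j)) has_sum g' (v $ j)) UNIV"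
    using g'[of "v $ j"] r by (auto simp: has_sum_def)
  ultimately show "((\<lambda>n. c i n * dmpow (l + axis j 1) n v) has_sum partial_deriv j f v $ i) UNIV"
    unfolding dmpow_Suc by (simp add: mult_ac)
qed

lemma power_series_deriv_funpow:
  assumes "power_series_deriv c l f"
  shows "power_series_deriv c (l + axis j p) ((partial_deriv j ^^ p) f)"
proof (induction p)
  case 0
  then show ?case
    using assms by (simp add: axis_def zero_vec_def[symmetric])
next
  case (Suc p)
  have "l + axis j (Suc p) = l + axis j p + axis j 1"
    by (simp add: vec_eq_iff axis_def)
  then show ?case
    using power_series_deriv_partial_deriv[OF Suc, of j] by simp
qed

lemma power_series_deriv_foldr:
  assumes "power_series_deriv c 0 f" "distinct js"
  shows "power_series_deriv c (\<chi> k. if k \<in> set js then l $ k else 0)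
           (foldr (\<lambda>j. partial_deriv j ^^ (l $ j)) js f)"
  using assms(2)
proof (induction js)
  case Nil
  then show ?case
    using assms(1) by (simp add: zero_vec_def)
next
  case (Cons j js)
  have "(\<chi> k. if k \<in> set (j # js) then l $ k else 0) =
      (\<chi> k. if k \<in> set js then l $ k else 0) + axis j (l $ j)"
    using Cons.prems by (auto simp: vec_eq_iff axis_def)
  then show ?case
    using power_series_deriv_funpow[OF Cons.IH, of j "l $ j"] Cons.prems by simp
qed

text \<open>Whatever enumeration \<open>SOME\<close> returns, each coordinate occurs in it exactly
  once, so the accumulated order is \<open>l\<close>; the value on the polydisc is then fixed by the
  differentiated series.\<close>

lemma power_series_deriv_mixed_deriv:
  fixes l :: "nat ^ 'd::finite"
  assumes "power_series_deriv c 0 f"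
  shows "power_series_deriv c l (mixed_deriv l f)"
proof -
  let ?js = "SOME js. distinct js \<and> set js = (UNIV :: 'd set)"
  have "\<exists>js. distinct js \<and> set js = (UNIV :: 'd set)"
  proof -
    have "finite (UNIV :: 'd set)"
      by (rule finite)
    then obtain js where "set js = (UNIV :: 'd set)" "distinct js"
      using finite_distinct_list by metis
    then show ?thesis
      by (intro exI[of _ js] conjI)
  qed
  then have "distinct ?js \<and> set ?js = UNIV"
    by (rule someI_ex)
  then show ?thesis
    using power_series_deriv_foldr[OF assms, of ?js l] unfolding mixed_deriv_def by (simp del: some_eq_ex)
qed

subsection \<open>Multiplying out and residue classes\<close>

lemma has_sum_finite_sum:
  fixes f :: "'i \<Rightarrow> 'a \<Rightarrow> 'b::topological_comm_monoid_add"
  assumes "finite I" "\<And>k. k \<in> I \<Longrightarrow> (f k has_sum S k) A"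
  shows "((\<lambda>x. \<Sum>k\<in>I. f k x) has_sum (\<Sum>k\<in>I. S k)) A"
  using assms by (induction I rule: finite_induct) (auto intro: has_sum_add)

text \<open>Puts the points at which the derivatives are evaluated into the polydisc, where the
  power series converge.\<close>

lemma norm_root_phi_less_1:
  assumes "0 < norm z" "norm z < 1" "m > 0" "lam > 0"
  shows "norm (root_phi m lam l z) < 1"
  using assms by (simp add: norm_root_phi powr01_less_one)

abbreviation choice_degree :: "('d::finite \<Rightarrow> nat + nat) \<Rightarrow> nat ^ 'd" where
  "choice_degree c \<equiv> (\<chi> j. case c j of Inl l \<Rightarrow> l | Inr l \<Rightarrow> 0)"

lemma term_choices_PiE:
  "term_choices lam mu = (\<Pi>\<^sub>E j\<in>UNIV. {..<Suc (mu $ j) - lam $ j} <+> {..<lam $ j})"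
proof -
  have "(case x of Inl l \<Rightarrow> l < a | Inr l \<Rightarrow> l < b) \<longleftrightarrow> x \<in> {..<a} <+> {..<b}" for x :: "nat + nat" and a b
    by (cases x) auto
  then show ?thesis
    by (simp add: term_choices_def PiE_UNIV_domain Pi_def)
qed

lemma finite_term_choices: "finite (term_choices lam mu)"
  unfolding term_choices_PiE by (intro finite_PiE) auto

lemma prod_sum_term_choices:
  fixes F :: "'d::finite \<Rightarrow> nat + nat \<Rightarrow> complex"
  shows "(\<Prod>j\<in>UNIV. (\<Sum>l<Suc (mu $ j) - lam $ j. F j (Inl l)) + (\<Sum>l<lam $ j. F j (Inr l))) =
    (\<Sum>c\<in>term_choices lam mu. \<Prod>j\<in>UNIV. F j (c j))"
proof -
  have "(\<Sum>l<a. F j (Inl l)) + (\<Sum>l<b. F j (Inr l)) = (\<Sum>x\<in>{..<a} <+> {..<b}. F j x)" for j a b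
    by (simp add: sum.Plus)
  then show ?thesis
    unfolding term_choices_PiE by (simp only:) (rule prod_sum_PiE; simp)
qed

text \<open>\<open>multiplies_out\<close> determines an index only through degree, coefficient and
  pole. A sum whose terms \<open>H\<close> depend on nothing else can be moved from \<open>L\<close>
  to the choices, which eliminates \<open>\<nu>\<close>; this serves the sum of fractions and the
  sum of derivatives alike.\<close>

lemma multiplies_out_sum:
  fixes z :: "complex ^ 'd::finite"
  assumes mo: "multiplies_out m lam mu \<sigma> \<tau> L \<eta> \<phi>" and z: "z \<in> punctured_polydisc"
    and H: "\<And>c. c \<in> term_choices lam mu \<Longrightarrow>
      H (choice_degree c)
        (\<Prod>j\<in>UNIV. case c j of Inl l \<Rightarrow> \<sigma> j l (z $ j) | Inr l \<Rightarrow> \<tau> j l (z $ j))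
        (\<chi> j. case c j of Inl l \<Rightarrow> 0 | Inr l \<Rightarrow> root_phi (m $ j) (lam $ j) l (z $ j)) = H' c"
  shows "(\<Sum>(l, \<nu>)\<in>L. H l (\<eta> (l, \<nu>) z) (\<phi> (l, \<nu>) z)) = (\<Sum>c\<in>term_choices lam mu. H' c)"
proof -
  obtain e where e: "bij_betw e (term_choices lam mu) L"
    and eq: "\<And>c. c \<in> term_choices lam mu \<Longrightarrow>
        fst (e c) = choice_degree c \<and>
        \<eta> (e c) z = (\<Prod>j\<in>UNIV. case c j of Inl l \<Rightarrow> \<sigma> j l (z $ j) | Inr l \<Rightarrow> \<tau> j l (z $ j)) \<and>
        \<phi> (e c) z = (\<chi> j. case c j of Inl l \<Rightarrow> 0 | Inr l \<Rightarrow> root_phi (m $ j) (lam $ j) l (z $ j))"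
    using mo z unfolding multiplies_out_def by blast
  have "(\<Sum>(l, \<nu>)\<in>L. H l (\<eta> (l, \<nu>) z) (\<phi> (l, \<nu>) z)) = (\<Sum>p\<in>L. H (fst p) (\<eta> p z) (\<phi> p z))"
    by (simp add: case_prod_beta)
  also have "\<dots> = (\<Sum>c\<in>term_choices lam mu. H (fst (e c)) (\<eta> (e c) z) (\<phi> (e c) z))"
    by (rule sum.reindex_bij_betw[OF e, symmetric])
  also have "\<dots> = (\<Sum>c\<in>term_choices lam mu. H' c)"
    by (intro sum.cong refl) (simp only: eq H)
  finally show ?thesis .
qed

lemma prod_pf_sum_multiplies_out:
  fixes z u :: "complex ^ 'd::finite"
  assumes mo: "multiplies_out m lam mu \<sigma> \<tau> L \<eta> \<phi>" and z: "z \<in> punctured_polydisc"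
  shows "(\<Prod>j\<in>UNIV. pf_sum (m $ j) (lam $ j) (mu $ j)
            (\<lambda>l. \<sigma> j l (z $ j)) (\<lambda>l. \<tau> j l (z $ j)) (z $ j) (u $ j)) =
         (\<Sum>(l, \<nu>)\<in>L. \<eta> (l, \<nu>) z / mpow (u - \<phi> (l, \<nu>) z) (l + 1))"
proof -
  let ?F = "\<lambda>j x. case x of Inl l \<Rightarrow> \<sigma> j l (z $ j) / (u $ j) ^ (l + 1)
     | Inr l \<Rightarrow> \<tau> j l (z $ j) / (u $ j - root_phi (m $ j) (lam $ j) l (z $ j))"
  have "(\<Prod>j\<in>UNIV. pf_sum (m $ j) (lam $ j) (mu $ j)
            (\<lambda>l. \<sigma> j l (z $ j)) (\<lambda>l. \<tau> j l (z $ j)) (z $ j) (u $ j)) =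
        (\<Sum>c\<in>term_choices lam mu. \<Prod>j\<in>UNIV. ?F j (c j))"
    using prod_sum_term_choices[where F = ?F, of mu lam] by (simp only: pf_sum_def sum.case)
  also have "\<dots> = (\<Sum>(l, \<nu>)\<in>L. \<eta> (l, \<nu>) z / mpow (u - \<phi> (l, \<nu>) z) (l + 1))"
    by (rule multiplies_out_sum[OF mo z, symmetric])
       (auto simp: mpow_def simp flip: prod_dividef intro!: prod.cong split: sum.split)
  finally show ?thesis .
qed

definition pf_sigmas :: "nat ^ 'd::finite \<Rightarrow> nat ^ 'd \<Rightarrow> nat ^ 'd \<Rightarrow> 'd \<Rightarrow> nat \<Rightarrow> complex \<Rightarrow> complex" where
  "pf_sigmas m lam mu j l z = pf_sigma (m $ j) (lam $ j) (mu $ j) z l"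

definition pf_taus :: "nat ^ 'd::finite \<Rightarrow> nat ^ 'd \<Rightarrow> nat ^ 'd \<Rightarrow> 'd \<Rightarrow> nat \<Rightarrow> complex \<Rightarrow> complex" where
  "pf_taus m lam mu j l z = pf_tau (m $ j) (lam $ j) (mu $ j) z l"

definition pf_moments :: "nat ^ 'd::finite \<Rightarrow> nat ^ 'd \<Rightarrow> nat ^ 'd \<Rightarrow> complex ^ 'd \<Rightarrow> nat ^ 'd \<Rightarrow> complex" where
  "pf_moments m lam mu z n = (\<Prod>j\<in>UNIV. pf_moment (m $ j) (lam $ j) (mu $ j) (z $ j) (n $ j))"

text \<open>Multiplying out in reverse: for fixed n the sum over the choices factors into a product
  over the coordinates, and each factor is the left-hand side of
  \<open>partial_fraction_moment\<close>. Only a finite sum has to be exchanged with the sum over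
  n.\<close>

lemma multiplies_out_has_sum_moments:
  fixes z :: "complex ^ 'd::finite"
  assumes mo: "multiplies_out m lam mu (pf_sigmas m lam mu) (pf_taus m lam mu) L \<eta> \<phi>"
    and z: "z \<in> punctured_polydisc" and m: "\<forall>j. 0 < m $ j" and lam: "\<forall>j. 0 < lam $ j"
    and f: "power_series_deriv c 0 f"
  shows "((\<lambda>n. c i n * pf_moments m lam mu z n) has_sum
     (\<Sum>(l, \<nu>)\<in>L. (\<eta> (l, \<nu>) z / mfact l) *s mixed_deriv l f (\<phi> (l, \<nu>) z)) $ i) UNIV"
proof -
  let ?co = "\<lambda>c. \<Prod>j\<in>UNIV. case c j of Inl l \<Rightarrow> pf_sigmas m lam mu j l (z $ j) | Inr l \<Rightarrow> pf_taus m lam mu j l (z $ j)"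
  let ?pt = "\<lambda>c. (\<chi> j. case c j of Inl l \<Rightarrow> 0 | Inr l \<Rightarrow> root_phi (m $ j) (lam $ j) l (z $ j)) :: complex ^ 'd"
  let ?T = "term_choices lam mu"
  have zj: "z $ j \<noteq> 0" "norm (z $ j) < 1" for j
    using z by (auto simp: punctured_polydisc_def)
  have "((\<lambda>n. \<Sum>d\<in>?T. ?co d / mfact (choice_degree d) * (c i n * dmpow (choice_degree d) n (?pt d))) has_sum
     (\<Sum>d\<in>?T. ?co d / mfact (choice_degree d) * mixed_deriv (choice_degree d) f (?pt d) $ i)) UNIV"
  proof (intro has_sum_finite_sum finite_term_choices has_sum_cmult_right)
    fix d assume "d \<in> ?T"
    have "?pt d \<in> polydisc"
      using zj m lam by (auto simp: polydisc_def norm_root_phi_less_1 split: sum.split)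
    then show "((\<lambda>n. c i n * dmpow (choice_degree d) n (?pt d)) has_sum
        mixed_deriv (choice_degree d) f (?pt d) $ i) UNIV"
      using power_series_deriv_mixed_deriv[OF f] unfolding power_series_deriv_def by blast
  qed
  also have "(\<Sum>d\<in>?T. ?co d / mfact (choice_degree d) * mixed_deriv (choice_degree d) f (?pt d) $ i) =
     (\<Sum>(l, \<nu>)\<in>L. (\<eta> (l, \<nu>) z / mfact l) *s mixed_deriv l f (\<phi> (l, \<nu>) z)) $ i"
  proof -
    have "(\<Sum>(l, \<nu>)\<in>L. \<eta> (l, \<nu>) z / mfact l * mixed_deriv l f (\<phi> (l, \<nu>) z) $ i) =
        (\<Sum>d\<in>?T. ?co d / mfact (choice_degree d) * mixed_deriv (choice_degree d) f (?pt d) $ i)"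
      by (rule multiplies_out_sum[OF mo z]) (rule refl)
    then show ?thesis
      by (simp add: case_prod_beta)
  qed
  also have "(\<lambda>n. \<Sum>d\<in>?T. ?co d / mfact (choice_degree d) * (c i n * dmpow (choice_degree d) n (?pt d))) =
     (\<lambda>n. c i n * pf_moments m lam mu z n)"
  proof
    fix n
    let ?F = "\<lambda>j x. case x of
        Inl l \<Rightarrow> pf_sigma (m $ j) (lam $ j) (mu $ j) (z $ j) l * (if n $ j = l then 1 else 0)
      | Inr l \<Rightarrow> pf_tau (m $ j) (lam $ j) (mu $ j) (z $ j) l * root_phi (m $ j) (lam $ j) l (z $ j) ^ (n $ j)"
    \<comment> \<open>At 0 the l-th derivative of x^n divided by l! is 1 for n = l and 0 otherwise,
      so the pole at 0 picks out a single coefficient; at phi_l no derivative is taken.\<close>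
    have "?co d / mfact (choice_degree d) * dmpow (choice_degree d) n (?pt d) = (\<Prod>j\<in>UNIV. ?F j (d j))" for d
      unfolding mfact_def dmpow_def prod_dividef[symmetric] prod.distrib[symmetric]
      by (intro prod.cong refl) (auto simp: dmon_at_0 dmon_0 pf_sigmas_def pf_taus_def split: sum.split)
    then have "(\<Sum>d\<in>?T. ?co d / mfact (choice_degree d) * (c i n * dmpow (choice_degree d) n (?pt d))) =
       c i n * (\<Sum>d\<in>?T. \<Prod>j\<in>UNIV. ?F j (d j))"
      by (simp only: sum_distrib_left mult.left_commute)
    also have "(\<Sum>d\<in>?T. \<Prod>j\<in>UNIV. ?F j (d j)) =
        (\<Prod>j\<in>UNIV. (\<Sum>l<Suc (mu $ j) - lam $ j. ?F j (Inl l)) + (\<Sum>l<lam $ j. ?F j (Inr l)))"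
      by (rule prod_sum_term_choices[where F = ?F, symmetric])
    also have "\<dots> = pf_moments m lam mu z n"
      unfolding pf_moments_def
    proof (intro prod.cong refl)
      fix j
      have "(\<Sum>l<N. a l * (if k = l then 1 else 0)) = (if k < N then a k else 0)" for N k and a :: "nat \<Rightarrow> complex"
        by (simp add: if_distrib[of "\<lambda>x. _ * x"] cong: if_cong)
      then show "(\<Sum>l<Suc (mu $ j) - lam $ j. ?F j (Inl l)) + (\<Sum>l<lam $ j. ?F j (Inr l)) =
          pf_moment (m $ j) (lam $ j) (mu $ j) (z $ j) (n $ j)"
        using partial_fraction_moment[of "z $ j" "lam $ j" "n $ j" "mu $ j" "m $ j"] zj lam by simp
    qed
    finally show "(\<Sum>d\<in>?T. ?co d / mfact (choice_degree d) * (c i n * dmpow (choice_degree d) n (?pt d))) =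
       c i n * pf_moments m lam mu z n" .
  qed
  finally show ?thesis .
qed

section \<open>Residue classes modulo \<open>m\<close> and their images under the map\<close>

lemma inj_affine_vec:
  fixes a k :: "nat ^ 'd::finite"
  assumes "\<forall>j. 0 < k $ j"
  shows "inj (\<lambda>q. a + k * q)"
proof (rule injI)
  fix x y assume eq: "a + k * x = a + k * y"
  have "k $ j * x $ j = k $ j * y $ j" for j
    using arg_cong[OF eq, of "\<lambda>v. v $ j"] by simp
  then have "x $ j = y $ j" for j
    using assms by (metis nat_mult_eq_cancel1)
  then show "x = y"
    by (simp add: vec_eq_iff)
qed

lemma pf_moments_affine:
  fixes z :: "complex ^ 'd::finite"
  assumes "\<forall>j. 0 < lam $ j"
  shows "pf_moments m lam mu z (mu + lam * q) = mpow z (m * q)"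
  using assms by (simp add: pf_moments_def pf_moment_def mpow_def power_mult)

lemma pf_moments_eq_0:
  assumes "n \<notin> range (\<lambda>q. mu + lam * q)"
  shows "pf_moments m lam mu z n = 0"
proof (rule ccontr)
  assume "pf_moments m lam mu z n \<noteq> 0"
  then have "\<forall>j. mu $ j \<le> n $ j \<and> lam $ j dvd n $ j - mu $ j"
    unfolding pf_moments_def pf_moment_def by (auto split: if_splits)
  then have "n = mu + lam * (\<chi> j. (n $ j - mu $ j) div lam $ j)"
    by (simp add: vec_eq_iff)
  then show False
    using assms by blast
qed

text \<open>The moments are supported on the multi-indices \<open>mu + lam * q\<close>, where they
  equal z^(m q); since lam > 0 makes this parametrisation injective, the sum over n is a reindexed
  sum over q.\<close>

lemma has_sum_pf_moments_iff:
  fixes c :: "nat ^ 'd::finite \<Rightarrow> complex"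
  assumes lam: "\<forall>j. 0 < lam $ j"
  shows "((\<lambda>n. c n * pf_moments m lam mu z n) has_sum S) UNIV \<longleftrightarrow>
         ((\<lambda>q. c (mu + lam * q) * mpow z (m * q)) has_sum S) UNIV"
proof -
  note inj = inj_affine_vec[OF lam, of mu]
  have 0: "c n * pf_moments m lam mu z n = 0" if "n \<notin> range (\<lambda>q. mu + lam * q)" for n
    using pf_moments_eq_0[OF that] by simp
  have "((\<lambda>n. c n * pf_moments m lam mu z n) has_sum S) UNIV \<longleftrightarrow>
        ((\<lambda>n. c n * pf_moments m lam mu z n) has_sum S) (range (\<lambda>q. mu + lam * q))"
    by (rule has_sum_cong_neutral) (use 0 in blast)+
  also have "\<dots> \<longleftrightarrow> ((\<lambda>q. c (mu + lam * q) * mpow z (m * q)) has_sum S) UNIV"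
    by (subst has_sum_reindex[OF inj]) (simp add: o_def pf_moments_affine[OF lam])
  finally show ?thesis .
qed

lemma finite_residue_box: "finite (residue_box m)"
proof -
  have "residue_box m \<subseteq> vec_lambda ` (\<Pi>\<^sub>E j\<in>UNIV. {..<m $ j})"
  proof
    fix r assume "r \<in> residue_box m"
    then have "($) r \<in> (\<Pi>\<^sub>E j\<in>UNIV. {..<m $ j})"
      by (auto simp: residue_box_def)
    then show "r \<in> vec_lambda ` (\<Pi>\<^sub>E j\<in>UNIV. {..<m $ j})"
      by (metis image_eqI vec_nth_inverse)
  qed
  then show ?thesis
    by (rule finite_subset) (intro finite_imageI finite_PiE; simp)
qed

text \<open>Each class is extended by zero to all multi-indices, which turns the partition into a
  finite sum of series over one index set; reduction modulo \<open>m\<close> names the single class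
  containing n.\<close>

lemma has_sum_residue_classes:
  fixes m :: "nat ^ 'd::finite" and g :: "nat ^ 'd \<Rightarrow> complex"
  assumes m: "\<forall>j. 0 < m $ j"
    and S: "\<And>r. r \<in> residue_box m \<Longrightarrow> ((\<lambda>q. g (r + m * q)) has_sum S r) UNIV"
  shows "(g has_sum (\<Sum>r\<in>residue_box m. S r)) UNIV"
proof -
  let ?C = "\<lambda>r. range (\<lambda>q. r + m * q)"
  have mem: "n \<in> ?C r \<longleftrightarrow> r = (\<chi> j. n $ j mod m $ j)" if "r \<in> residue_box m" for n r
  proof
    assume "n \<in> ?C r"
    then show "r = (\<chi> j. n $ j mod m $ j)"
      using that by (auto simp: vec_eq_iff residue_box_def)
  next
    assume "r = (\<chi> j. n $ j mod m $ j)"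
    then have "n = r + m * (\<chi> j. n $ j div m $ j)"
      by (simp add: vec_eq_iff)
    then show "n \<in> ?C r"
      by blast
  qed
  have "((\<lambda>n. if n \<in> ?C r then g n else 0) has_sum S r) UNIV" if r: "r \<in> residue_box m" for r
  proof -
    note inj = inj_affine_vec[OF m, of r]
    have "(g has_sum S r) (?C r)"
      using S[OF r] by (subst has_sum_reindex[OF inj]) (simp add: o_def)
    then show ?thesis
      by (subst has_sum_cong_neutral[where S = UNIV and T = "?C r" and g = g]) auto
  qed
  then have "((\<lambda>n. \<Sum>r\<in>residue_box m. if n \<in> ?C r then g n else 0) has_sum (\<Sum>r\<in>residue_box m. S r)) UNIV"
    by (intro has_sum_finite_sum finite_residue_box)
  moreover have "(\<Sum>r\<in>residue_box m. if n \<in> ?C r then g n else 0) = g n" for n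
  proof -
    have "(\<chi> j. n $ j mod m $ j) \<in> residue_box m"
      using m by (simp add: residue_box_def)
    then show ?thesis
      using mem by (simp add: finite_residue_box cong: sum.cong)
  qed
  ultimately show ?thesis
    by simp
qed

text \<open>For a diagonal matrix with entries a_i, \<open>C2a\<close> reads a_i m_i = lam_i, hence
  the increment m_i q_i is mapped to lam_i q_i. Off-diagonal entries would mix the coordinates of
  q.\<close>

lemma collatz_map_residue_class:
  fixes m :: "nat ^ 'd::finite"
  assumes C2a: "A r *v cvec m = cvec lam" and C2b: "A r *v cvec r + b r = cvec mu"
    and t: "is_collatz_map m A b t" and r: "r \<in> residue_box m"
    and diag: "\<forall>i j. i \<noteq> j \<longrightarrow> A r $ i $ j = 0"
  shows "t (r + m * q) = mu + lam * q"
proof -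
  have A: "(A r *v x) $ i = A r $ i $ i * x $ i" for x i
    unfolding matrix_vector_mult_def using diag by (simp add: sum.remove[of UNIV i])
  have "cvec (t (r + m * q)) = A r *v cvec (r + m * q) + b r"
    using t r by (auto simp: is_collatz_map_def cong_def)
  then have "of_nat (t (r + m * q) $ i) = (of_nat ((mu + lam * q) $ i) :: complex)" for i
  proof -
    assume eq: "cvec (t (r + m * q)) = A r *v cvec (r + m * q) + b r"
    have "A r $ i $ i * of_nat (m $ i) = of_nat (lam $ i)"
      using A[of "cvec m" i] unfolding C2a by (simp add: cvec_def)
    moreover have "A r $ i $ i * of_nat (r $ i) + b r $ i = of_nat (mu $ i)"
      using arg_cong[OF C2b, of "\<lambda>v. v $ i"] A[of "cvec r" i] by (simp add: cvec_def)
    moreover have "of_nat (t (r + m * q) $ i) = A r $ i $ i * of_nat (r $ i + m $ i * q $ i) + b r $ i"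
      using arg_cong[OF eq, of "\<lambda>v. v $ i"] A[of "cvec (r + m * q)" i] by (simp add: cvec_def)
    moreover have "\<dots> = (A r $ i $ i * of_nat (r $ i) + b r $ i) + A r $ i $ i * of_nat (m $ i) * of_nat (q $ i)"
      by (simp add: algebra_simps)
    ultimately show ?thesis
      by simp
  qed
  then have "t (r + m * q) $ i = (mu + lam * q) $ i" for i
    by (simp only: of_nat_eq_iff)
  then show ?thesis
    by (subst vec_eq_iff) blast
qed

text \<open>\<open>S r\<close> stays abstract so that both the sum of derivatives and the torus
  integral can be inserted for it.\<close>

lemma has_sum_collatz:
  fixes m :: "nat ^ 'd::finite" and c :: "nat ^ 'd \<Rightarrow> complex"
  assumes m: "\<forall>j. 0 < m $ j" and lam: "\<And>r. r \<in> residue_box m \<Longrightarrow> \<forall>j. 0 < lam r $ j"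
    and t: "\<And>r q. r \<in> residue_box m \<Longrightarrow> t (r + m * q) = mu r + lam r * q"
    and S: "\<And>r. r \<in> residue_box m \<Longrightarrow> ((\<lambda>n. c n * pf_moments m (lam r) (mu r) z n) has_sum S r) UNIV"
  shows "((\<lambda>n. mpow z n * c (t n)) has_sum (\<Sum>r\<in>residue_box m. mpow z r * S r)) UNIV"
proof (rule has_sum_residue_classes[OF m])
  fix r assume r: "r \<in> residue_box m"
  have "((\<lambda>q. mpow z r * (c (mu r + lam r * q) * mpow z (m * q))) has_sum mpow z r * S r) UNIV"
    using S[OF r] has_sum_pf_moments_iff[OF lam[OF r], of c m "mu r" z "S r"]
    by (intro has_sum_cmult_right) blast
  then show "((\<lambda>q. mpow z (r + m * q) * c (t (r + m * q))) has_sum mpow z r * S r) UNIV"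
    unfolding t[OF r] by (simp add: mpow_def power_add prod.distrib mult_ac)
qed

text \<open>Any injection of the finite set of choices that records the degree will do. Here
  \<open>\<nu>\<close> comes from a numbering shifted by \<open>Suc\<close>, so that 0 stays free
  for one distinguished choice, and the families are read off through the inverse of the
  injection.\<close>

lemma ex_multiplies_out:
  fixes m lam mu :: "nat ^ 'd::finite"
  assumes lam: "\<forall>j. 0 < lam $ j"
  shows "\<exists>L \<eta> \<phi>. finite L \<and> (0, 0) \<in> L \<and> multiplies_out m lam mu \<sigma> \<tau> L \<eta> \<phi>"
proof -
  let ?T = "term_choices lam mu"
  let ?c0 = "(\<lambda>_. Inr 0) :: 'd \<Rightarrow> nat + nat"
  obtain h0 :: "('d \<Rightarrow> nat + nat) \<Rightarrow> nat" where h0: "inj_on h0 ?T"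
    using finite_imp_inj_to_nat_seg[OF finite_term_choices] by blast
  \<comment> \<open>The all-\<open>Inr 0\<close> choice exists because \<open>\<lambda> > 0\<close>; it receives the index \<open>(0, 0)\<close>.\<close>
  define e where "e = (\<lambda>c. (choice_degree c, if c = ?c0 then 0 else Suc (h0 c)))"
  have inj: "inj_on e ?T"
    using h0 by (auto simp: inj_on_def e_def)
  have "?c0 \<in> ?T"
    using lam by (simp add: term_choices_def)
  moreover have "e ?c0 = (0, 0)"
    by (simp add: e_def zero_vec_def)
  ultimately have 0: "(0, 0) \<in> e ` ?T"
    by (metis image_eqI)
  let ?i = "inv_into ?T e"
  have "multiplies_out m lam mu \<sigma> \<tau> (e ` ?T)
     (\<lambda>p z. \<Prod>j\<in>UNIV. case ?i p j of Inl l \<Rightarrow> \<sigma> j l (z $ j) | Inr l \<Rightarrow> \<tau> j l (z $ j))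
     (\<lambda>p z. \<chi> j. case ?i p j of Inl l \<Rightarrow> 0 | Inr l \<Rightarrow> root_phi (m $ j) (lam $ j) l (z $ j))"
    unfolding multiplies_out_def
  proof (intro exI[of _ e] conjI ballI)
    show "bij_betw e ?T (e ` ?T)"
      using inj by (simp add: bij_betw_def)
    fix c assume c: "c \<in> ?T"
    show "fst (e c) = choice_degree c"
      by (simp add: e_def)
  qed (simp_all only: inv_into_f_f[OF inj])
  with 0 show ?thesis
    using finite_term_choices by blast
qed

text \<open>Both families enumerate the same choices, so one enumeration composed with the inverse
  of the other matches them.\<close>

lemma multiplies_out_unique:
  assumes "multiplies_out m lam mu \<sigma> \<tau> L \<eta> \<phi>" "multiplies_out m lam mu \<sigma> \<tau> L' \<eta>' \<phi>'"
  shows "\<exists>g. bij_betw g L' L \<and> (\<forall>p\<in>L'. fst (g p) = fst p \<and>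
           (\<forall>z\<in>punctured_polydisc. \<eta>' p z = \<eta> (g p) z \<and> \<phi>' p z = \<phi> (g p) z))"
proof -
  let ?T = "term_choices lam mu"
  obtain e where e: "bij_betw e ?T L" and e_eq: "\<forall>c\<in>?T. fst (e c) = choice_degree c \<and>
      (\<forall>z\<in>punctured_polydisc.
          \<eta> (e c) z = (\<Prod>j\<in>UNIV. case c j of Inl l \<Rightarrow> \<sigma> j l (z $ j) | Inr l \<Rightarrow> \<tau> j l (z $ j)) \<and>
          \<phi> (e c) z = (\<chi> j. case c j of Inl l \<Rightarrow> 0 | Inr l \<Rightarrow> root_phi (m $ j) (lam $ j) l (z $ j)))"
    using assms(1) unfolding multiplies_out_def by blast
  obtain e' where e': "bij_betw e' ?T L'" and e'_eq: "\<forall>c\<in>?T. fst (e' c) = choice_degree c \<and>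
      (\<forall>z\<in>punctured_polydisc.
          \<eta>' (e' c) z = (\<Prod>j\<in>UNIV. case c j of Inl l \<Rightarrow> \<sigma> j l (z $ j) | Inr l \<Rightarrow> \<tau> j l (z $ j)) \<and>
          \<phi>' (e' c) z = (\<chi> j. case c j of Inl l \<Rightarrow> 0 | Inr l \<Rightarrow> root_phi (m $ j) (lam $ j) l (z $ j)))"
    using assms(2) unfolding multiplies_out_def by blast
  let ?i = "inv_into ?T e'"
  have i: "bij_betw ?i L' ?T"
    by (rule bij_betw_inv_into[OF e'])
  show ?thesis
  proof (intro exI[of _ "e \<circ> ?i"] conjI ballI)
    show "bij_betw (e \<circ> ?i) L' L"
      by (rule bij_betw_trans[OF i e])
    fix p assume p: "p \<in> L'"
    then have c: "?i p \<in> ?T" "e' (?i p) = p"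
      using i e' by (auto simp: bij_betw_def f_inv_into_f)
    show "fst ((e \<circ> ?i) p) = fst p"
      using bspec[OF e_eq c(1)] bspec[OF e'_eq c(1)] c(2) by simp
    fix z :: "complex ^ 'a" assume z: "z \<in> punctured_polydisc"
    show "\<eta>' p z = \<eta> ((e \<circ> ?i) p) z" "\<phi>' p z = \<phi> ((e \<circ> ?i) p) z"
      using bspec[OF e_eq c(1)] bspec[OF e'_eq c(1)] c(2) z by simp_all
  qed
qed

subsection \<open>The torus integral\<close>

lemma bij_betw_axis_Basis: "bij_betw (\<lambda>j. axis j (1::real)) UNIV (Basis :: (real ^ 'd::finite) set)"
  by (auto simp: bij_betw_def inj_on_def axis_eq_axis Basis_vec_def)

text \<open>Fubini for a product integrand: \<open>lborel\<close> on the vector space is the image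
  of the product of the one-dimensional measures over the basis vectors. Indicators cut the factors
  off, so that the cube can be replaced by the whole space.\<close>

lemma has_integral_prod_cbox:
  fixes h :: "'d::finite \<Rightarrow> real \<Rightarrow> complex"
  assumes cont: "\<And>j. continuous_on {0..1} (h j)"
  shows "((\<lambda>x. \<Prod>j\<in>UNIV. h j (x $ j)) has_integral (\<Prod>j\<in>UNIV. integral {0..1} (h j))) (cbox 0 (1 :: real ^ 'd))"
proof -
  define H where "H = (\<lambda>j t. indicator {0..1} t *\<^sub>R h j t)"
  have int: "integrable lborel (H j)" and int_eq: "integral\<^sup>L lborel (H j) = integral {0..1} (h j)" for j
  proof -
    have *: "set_integrable lborel {0..1} (h j)"
      by (rule borel_integrable_atLeastAtMost'[OF cont])
    then show "integrable lborel (H j)"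
      by (simp add: set_integrable_def H_def)
    show "integral\<^sup>L lborel (H j) = integral {0..1} (h j)"
      using set_borel_integral_eq_integral(2)[OF *] by (simp add: set_lebesgue_integral_def H_def)
  qed
  have meas [measurable]: "H j \<in> borel_measurable borel" for j
    using borel_measurable_integrable[OF int, of j] by simp
  let ?ax = "\<lambda>j. axis j 1 :: real ^ 'd"
  let ?S = "\<lambda>y. \<Sum>b\<in>Basis. y b *\<^sub>R b :: real ^ 'd"
  let ?G = "\<lambda>x :: real ^ 'd. \<Prod>j\<in>UNIV. H j (x $ j)"
  let ?P = "\<Pi>\<^sub>M b\<in>(Basis :: (real ^ 'd) set). (lborel :: real measure)"
  let ?Hb = "\<lambda>b. H (inv_into UNIV ?ax b)"
  interpret product_sigma_finite "\<lambda>_ :: real ^ 'd. lborel :: real measure"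
    by standard
  have inv: "inv_into UNIV ?ax (?ax j) = j" for j
    by (rule inv_into_f_f) (auto simp: inj_on_def axis_eq_axis)
  have coord: "?S y $ j = y (?ax j)" for y j
  proof -
    have "?S y $ j = ?S y \<bullet> ?ax j"
      by (simp add: inner_axis)
    also have "\<dots> = y (?ax j)"
      by (simp add: inner_sum_left_Basis axis_in_Basis_iff)
    finally show ?thesis .
  qed
  have G: "?G (?S y) = (\<Prod>b\<in>Basis. ?Hb b (y b))" for y
    unfolding coord using prod.reindex_bij_betw[OF bij_betw_axis_Basis, of "\<lambda>b. ?Hb b (y b)"]
    by (simp add: inv)
  have measG: "?G \<in> borel_measurable borel"
    by measurable
  have measS: "?S \<in> measurable ?P borel"
    by measurable
  have "integrable ?P (\<lambda>y. \<Prod>b\<in>Basis. ?Hb b (y b))"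
    by (intro product_integrable_prod int) auto
  then have intG: "integrable lborel ?G"
    by (subst lborel_eq, subst integrable_distr_eq[OF measS measG]) (simp only: G)
  have "integral\<^sup>L lborel ?G = integral\<^sup>L ?P (\<lambda>y. ?G (?S y))"
    by (subst lborel_eq, subst integral_distr[OF measS measG]) (rule refl)
  also have "\<dots> = (\<Prod>b\<in>Basis. integral\<^sup>L lborel (?Hb b))"
    unfolding G by (intro product_integral_prod int) auto
  also have "\<dots> = (\<Prod>j\<in>UNIV. integral {0..1} (h j))"
    using prod.reindex_bij_betw[OF bij_betw_axis_Basis, of "\<lambda>b. integral\<^sup>L lborel (?Hb b)"]
    by (simp add: inv int_eq)
  finally have "(?G has_integral (\<Prod>j\<in>UNIV. integral {0..1} (h j))) UNIV"
    using has_integral_integral_lborel[OF intG] by simp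
  moreover have "?G x = (if x \<in> cbox 0 1 then \<Prod>j\<in>UNIV. h j (x $ j) else 0)" for x
  proof (cases "x \<in> cbox 0 1")
    case False
    then obtain j where "x $ j \<notin> {0..1}"
      by (auto simp: mem_box_cart)
    then have "H j (x $ j) = 0"
      by (simp add: H_def)
    then have "?G x = 0"
      by (intro prod_zero) auto
    with False show ?thesis
      by simp
  qed (auto simp: H_def mem_box_cart intro!: prod.cong)
  ultimately show ?thesis
    by (simp add: has_integral_restrict_UNIV)
qed

text \<open>A vector is rebuilt from its complex coordinates by the bounded linear maps
  \<open>axis i\<close>, so scalar integrals suffice.\<close>

lemma has_integral_vec:
  fixes f :: "'a::euclidean_space \<Rightarrow> complex ^ 'd::finite"
  assumes "\<And>i. ((\<lambda>x. f x $ i) has_integral I $ i) S"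
  shows "(f has_integral I) S"
proof -
  have ax: "(\<Sum>i\<in>UNIV. axis i (v $ i)) = v" for v :: "complex ^ 'd"
    by (simp add: vec_eq_iff axis_def if_distrib cong: if_cong)
  have "bounded_linear (axis i :: complex \<Rightarrow> complex ^ 'd)" for i
    by (rule linear_conv_bounded_linear[THEN iffD1], rule linearI) (auto simp: vec_eq_iff axis_def)
  then have "((\<lambda>x. \<Sum>i\<in>UNIV. axis i (f x $ i)) has_integral (\<Sum>i\<in>UNIV. axis i (I $ i))) S"
    using has_integral_linear[OF assms] by (intro has_integral_sum) (auto simp: o_def)
  then show ?thesis
    by (simp only: ax)
qed

text \<open>On the torus each |u_j| is constant, so every term of the series has the modulus it
  takes at the real point with coordinates rho_j, which lies in the polydisc. With a bound on the
  weight over the compact cube, the M-test permits integration term by term, and a monomial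
  integrates to a product of one-variable contour integrals.\<close>

lemma torus_integral_has_sum:
  fixes \<rho> :: "real ^ 'd::finite" and f :: "complex ^ 'd \<Rightarrow> complex ^ 'd"
  assumes f: "power_series_deriv c 0 f"
    and \<rho>: "\<And>j. 0 < \<rho> $ j" "\<And>j. \<rho> $ j < 1"
    and K: "\<And>j. continuous_on (sphere 0 (\<rho> $ j)) (K j)"
  shows "((\<lambda>n. c i n * (\<Prod>j\<in>UNIV. contour_integral (circlepath 0 (\<rho> $ j)) (\<lambda>u. K j u * u ^ (n $ j))))
     has_sum torus_integral \<rho> (\<lambda>u. (\<Prod>j\<in>UNIV. K j (u $ j)) *s f u) $ i) UNIV"
proof -
  let ?\<gamma> = "\<lambda>j. circlepath 0 (\<rho> $ j)"
  let ?\<Gamma> = "\<lambda>x :: real ^ 'd. \<chi> j. ?\<gamma> j (x $ j)"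
  let ?D = "\<lambda>j t. vector_derivative (?\<gamma> j) (at t)"
  let ?W = "\<lambda>x. \<Prod>j\<in>UNIV. ?D j (x $ j) * K j (?\<gamma> j (x $ j))"
  let ?CI = "\<lambda>n. \<Prod>j\<in>UNIV. contour_integral (?\<gamma> j) (\<lambda>u. K j u * u ^ (n $ j))"
  have sph: "?\<gamma> j t \<in> sphere 0 (\<rho> $ j)" for j t
    using \<rho>(1)[of j] by (simp add: circlepath norm_mult)
  have cont\<gamma>: "continuous_on S (?\<gamma> j)" for S j
    unfolding circlepath by (intro continuous_intros)
  have contD: "continuous_on S (?D j)" for S j
    unfolding vector_derivative_circlepath by (intro continuous_intros)
  have contK: "continuous_on S (\<lambda>t. K j (?\<gamma> j t))" for S j
    using continuous_on_compose2[OF K cont\<gamma>] sph by blast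
  have contW: "continuous_on (cbox 0 1) ?W"
    by (intro continuous_intros continuous_on_compose2[OF contD] continuous_on_compose2[OF contK]) auto
  then have "bounded (?W ` cbox 0 1)"
    by (intro compact_imp_bounded compact_continuous_image) auto
  then obtain B where B: "\<And>x. x \<in> cbox 0 1 \<Longrightarrow> norm (?W x) \<le> B"
    by (auto simp: bounded_iff)
  have poly: "?\<Gamma> x \<in> polydisc" for x
    using sph \<rho>(2) by (simp add: polydisc_def dist_norm)
  let ?\<rho> = "(\<chi> j. complex_of_real (\<rho> $ j)) :: complex ^ 'd"
  have "?\<rho> \<in> polydisc"
    using \<rho> by (auto simp: polydisc_def abs_of_pos)
  then have "(\<lambda>n. c k n * dmpow 0 n ?\<rho>) summable_on UNIV" for k
    using f unfolding power_series_deriv_def by (blast intro: has_sum_imp_summable)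
  then have summ: "(\<lambda>n. norm (c k n * dmpow 0 n ?\<rho>) * B) summable_on UNIV" for k
    by (intro summable_on_cmult_left) (simp only: summable_on_iff_abs_summable_on_complex)
  have int: "((\<lambda>x. \<Prod>j\<in>UNIV. K j (?\<gamma> j (x $ j)) * ?\<gamma> j (x $ j) ^ (n $ j) * ?D j (x $ j)) has_integral ?CI n) (cbox 0 1)" for n
    unfolding contour_integral_integral by (intro has_integral_prod_cbox continuous_intros contK cont\<gamma> contD)
  have ex: "\<exists>J. ((\<lambda>x. f (?\<Gamma> x) $ k * ?W x) has_integral J) (cbox 0 1) \<and>
      ((\<lambda>n. c k n * ?CI n) has_sum J) UNIV" for k
  proof -
    let ?g = "\<lambda>n x. c k n * (\<Prod>j\<in>UNIV. K j (?\<gamma> j (x $ j)) * ?\<gamma> j (x $ j) ^ (n $ j) * ?D j (x $ j))"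
    have g: "?g n x = c k n * dmpow 0 n (?\<Gamma> x) * ?W x" for n x
      by (simp add: dmpow_def dmon_0 prod.distrib mult_ac)
    have nd: "norm (dmpow 0 n (?\<Gamma> x)) = norm (dmpow 0 n ?\<rho>)" for n x
      using sph \<rho>(1) by (simp add: dmpow_def dmon_0 norm_power less_imp_le flip: prod_norm)
    have "norm (?g n x) = norm (c k n * dmpow 0 n ?\<rho>) * norm (?W x)" for n x
      unfolding g by (simp only: norm_mult nd)
    then have le: "norm (?g n x) \<le> norm (c k n * dmpow 0 n ?\<rho>) * B" if "x \<in> cbox 0 1" for n x
      using mult_left_mono[OF B[OF that] norm_ge_zero] by (simp only:)
    have "((\<lambda>n. ?g n x) has_sum f (?\<Gamma> x) $ k * ?W x) UNIV" for x
      unfolding g using f poly by (intro has_sum_cmult_left) (simp add: power_series_deriv_def)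
    then have "uniform_limit (cbox 0 1) (\<lambda>X x. \<Sum>n\<in>X. ?g n x) (\<lambda>x. f (?\<Gamma> x) $ k * ?W x) (finite_subsets_at_top UNIV)"
      by (intro Weierstrass_m_test_general'[OF le _ summ])
    moreover have "continuous_on (cbox 0 1) (\<lambda>x. \<Sum>n\<in>X. ?g n x)" for X
      by (intro continuous_intros continuous_on_compose2[OF contD] continuous_on_compose2[OF contK]
            continuous_on_compose2[OF cont\<gamma>]) auto
    ultimately obtain I J where I: "\<And>X. ((\<lambda>x. \<Sum>n\<in>X. ?g n x) has_integral I X) (cbox 0 1)"
      and J: "((\<lambda>x. f (?\<Gamma> x) $ k * ?W x) has_integral J) (cbox 0 1)"
      and lim: "(I \<longlongrightarrow> J) (finite_subsets_at_top UNIV)"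
      by (rule uniform_limit_integral_cbox) auto
    have "I X = (\<Sum>n\<in>X. c k n * ?CI n)" if "finite X" for X
      using I[of X] by (rule has_integral_unique) (intro has_integral_sum has_integral_mult_right int that)
    then have "\<forall>\<^sub>F X in finite_subsets_at_top UNIV. I X = (\<Sum>n\<in>X. c k n * ?CI n)"
      by (intro eventually_finite_subsets_at_top_weakI)
    with lim have "((\<lambda>n. c k n * ?CI n) has_sum J) UNIV"
      unfolding has_sum_def by (rule Lim_transform_eventually)
    with J show ?thesis
      by blast
  qed
  define J where "J = (\<chi> k. \<Sum>\<^sub>\<infinity>n. c k n * ?CI n)"
  have J: "((\<lambda>x. f (?\<Gamma> x) $ k * ?W x) has_integral J $ k) (cbox 0 1)"
    and sum: "((\<lambda>n. c k n * ?CI n) has_sum J $ k) UNIV" for k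
    using ex[of k] by (auto simp: J_def dest: infsumI)
  have "((\<lambda>x. (\<Prod>j\<in>UNIV. ?D j (x $ j)) *s ((\<Prod>j\<in>UNIV. K j (?\<Gamma> x $ j)) *s f (?\<Gamma> x))) has_integral J) (cbox 0 1)"
    by (rule has_integral_vec) (use J in \<open>simp add: prod.distrib mult_ac\<close>)
  then have "torus_integral \<rho> (\<lambda>u. (\<Prod>j\<in>UNIV. K j (u $ j)) *s f u) = J"
    unfolding torus_integral_def by (rule integral_unique)
  then show ?thesis
    using sum by simp
qed

text \<open>The poles, 0 and the phi_l of modulus |z|^(m/lam), all lie inside the circle, so
  Cauchy's formula for derivatives applies to each partial fraction;
  \<open>partial_fraction_moment\<close> adds up the results.\<close>

lemma has_contour_integral_pf_kernel:
  assumes z: "z \<noteq> 0" "lam > 0" and \<rho>: "norm z powr (real m / real lam) < \<rho>"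
  shows "continuous_on (sphere 0 \<rho>) (pf_kernel m lam mu z)"
    and "contour_integral (circlepath 0 \<rho>) (\<lambda>u. pf_kernel m lam mu z u * u ^ n) =
           2 * pi * \<i> * pf_moment m lam mu z n"
proof -
  let ?\<phi> = "\<lambda>l. root_phi m lam l z"
  have \<rho>0: "\<rho> > 0"
    using \<rho> powr_ge_zero[of "norm z" "real m / real lam"] by linarith
  have \<phi>: "norm (?\<phi> l) < \<rho>" for l
    using \<rho> z by (simp add: norm_root_phi)
  have ne: "u \<noteq> 0" "u ^ lam \<noteq> z ^ m" if "u \<in> sphere 0 \<rho>" for u
    using that \<rho>0 \<phi> power_eq_iff_root_phi[OF z] by force+
  show "continuous_on (sphere 0 \<rho>) (pf_kernel m lam mu z)"
    unfolding pf_kernel_def using ne by (intro continuous_intros) auto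
  have cauchy: "((\<lambda>u. u ^ n / (u - w) ^ Suc k) has_contour_integral
      (2 * pi * \<i> * (of_nat (n choose k) * w ^ (n - k)))) (circlepath 0 \<rho>)" if "norm w < \<rho>" for w k
  proof -
    have "((\<lambda>u. u ^ n / (u - w) ^ Suc k) has_contour_integral
      (2 * pi * \<i> / fact k * (deriv ^^ k) (\<lambda>u. u ^ n) w)) (circlepath 0 \<rho>)"
      using that by (intro Cauchy_has_contour_integral_higher_derivative_circlepath continuous_intros holomorphic_intros) auto
    moreover have "(deriv ^^ k) (\<lambda>u. u ^ n) w = dmon k n (w :: complex)"
    proof (induction k arbitrary: w)
      case (Suc k)
      have "(deriv ^^ k) (\<lambda>u :: complex. u ^ n) = dmon k n"
        using Suc by blast
      then show ?case
        by (simp add: DERIV_imp_deriv[OF has_field_derivative_dmon])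
    qed (simp add: dmon_0)
    ultimately show ?thesis
      by (simp add: dmon_def mult_ac)
  qed
  have "((\<lambda>u. (\<Sum>l<Suc mu - lam. pf_sigma m lam mu z l * (u ^ n / (u - 0) ^ Suc l)) +
             (\<Sum>l<lam. pf_tau m lam mu z l * (u ^ n / (u - ?\<phi> l) ^ Suc 0))) has_contour_integral
      ((\<Sum>l<Suc mu - lam. pf_sigma m lam mu z l * (2 * pi * \<i> * (of_nat (n choose l) * 0 ^ (n - l)))) +
       (\<Sum>l<lam. pf_tau m lam mu z l * (2 * pi * \<i> * (of_nat (n choose 0) * ?\<phi> l ^ (n - 0))))))
      (circlepath 0 \<rho>)"
    by (intro has_contour_integral_add has_contour_integral_sum has_contour_integral_lmul cauchy finite_lessThan)
       (use \<phi> \<rho>0 in auto)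
  also have "(\<Sum>l<Suc mu - lam. pf_sigma m lam mu z l * (2 * pi * \<i> * (of_nat (n choose l) * 0 ^ (n - l)))) +
       (\<Sum>l<lam. pf_tau m lam mu z l * (2 * pi * \<i> * (of_nat (n choose 0) * ?\<phi> l ^ (n - 0)))) =
      2 * pi * \<i> * pf_moment m lam mu z n"
  proof -
    \<comment> \<open>For n < l the truncated exponent gives 0^0 = 1, but then the binomial
      coefficient is 0.\<close>
    have "of_nat (n choose l) * 0 ^ (n - l) = (if l = n then 1 else 0 :: complex)" for l
      by (auto simp: power_0_left binomial_eq_0)
    then have "(\<Sum>l<Suc mu - lam. pf_sigma m lam mu z l * (2 * pi * \<i> * (of_nat (n choose l) * 0 ^ (n - l)))) =
        2 * pi * \<i> * (if n < Suc mu - lam then pf_sigma m lam mu z n else 0)"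
      by (simp add: if_distrib[of "\<lambda>x. _ * x"] cong: if_cong)
    moreover have "(\<Sum>l<lam. pf_tau m lam mu z l * (2 * pi * \<i> * (of_nat (n choose 0) * ?\<phi> l ^ (n - 0)))) =
        2 * pi * \<i> * (\<Sum>l<lam. pf_tau m lam mu z l * ?\<phi> l ^ n)"
      by (simp add: sum_distrib_left mult_ac)
    ultimately show ?thesis
      by (simp only: flip: distrib_left partial_fraction_moment[OF z])
  qed
  finally have "((\<lambda>u. (\<Sum>l<Suc mu - lam. pf_sigma m lam mu z l * (u ^ n / (u - 0) ^ Suc l)) +
             (\<Sum>l<lam. pf_tau m lam mu z l * (u ^ n / (u - ?\<phi> l) ^ Suc 0))) has_contour_integral
      2 * pi * \<i> * pf_moment m lam mu z n) (circlepath 0 \<rho>)" .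
  then have "((\<lambda>u. pf_kernel m lam mu z u * u ^ n) has_contour_integral
      2 * pi * \<i> * pf_moment m lam mu z n) (circlepath 0 \<rho>)"
  proof (rule has_contour_integral_eq)
    fix u assume "u \<in> path_image (circlepath 0 \<rho>)"
    then have u: "u \<in> sphere 0 \<rho>"
      using \<rho>0 by simp
    have "pf_kernel m lam mu z u = pf_sum m lam mu (pf_sigma m lam mu z) (pf_tau m lam mu z) z u"
      using is_partial_fraction_sigma_tau[OF z] ne[OF u] unfolding is_partial_fraction_def by blast
    then show "(\<Sum>l<Suc mu - lam. pf_sigma m lam mu z l * (u ^ n / (u - 0) ^ Suc l)) +
             (\<Sum>l<lam. pf_tau m lam mu z l * (u ^ n / (u - ?\<phi> l) ^ Suc 0)) = pf_kernel m lam mu z u * u ^ n"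
      by (simp add: pf_sum_def distrib_right sum_distrib_right)
  qed
  then show "contour_integral (circlepath 0 \<rho>) (\<lambda>u. pf_kernel m lam mu z u * u ^ n) =
      2 * pi * \<i> * pf_moment m lam mu z n"
    by (rule contour_integral_unique)
qed

subsection \<open>Growth of the orbits and the generating functions\<close>

text \<open>Multiplying out infinite series over multi-indices needs absolute convergence, which for
  complex series follows from unconditional convergence.\<close>

lemma has_sum_prod_vec:
  fixes g :: "'d::finite \<Rightarrow> nat \<Rightarrow> complex"
  assumes g: "\<And>j. (g j has_sum S j) UNIV"
  shows "((\<lambda>n :: nat ^ 'd. \<Prod>j\<in>UNIV. g j (n $ j)) has_sum (\<Prod>j\<in>UNIV. S j)) UNIV"
proof -
  let ?U = "\<Pi>\<^sub>E j\<in>(UNIV :: 'd set). (UNIV :: nat set)"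
  have summ: "Infinite_Sum.abs_summable_on (g j) UNIV" for j
    using has_sum_imp_summable[OF g] by (simp only: summable_on_iff_abs_summable_on_complex)
  \<comment> \<open>The product rule is stated for the other notion of absolute summability;
    \<open>abs_summable_equivalent\<close> passes between the two.\<close>
  have "Infinite_Set_Sum.abs_summable_on (\<lambda>h. \<Prod>j\<in>UNIV. g j (h j)) ?U"
    using summ by (intro abs_summable_on_prod_PiE) (auto simp: abs_summable_equivalent)
  then have "(\<lambda>h. \<Prod>j\<in>UNIV. g j (h j)) summable_on ?U"
    by (metis abs_summable_equivalent summable_on_iff_abs_summable_on_complex)
  moreover have "infsum (\<lambda>h. \<Prod>j\<in>UNIV. g j (h j)) ?U = (\<Prod>j\<in>UNIV. S j)"
    by (subst infsum_prod_PiE_abs) (simp_all add: summ infsumI[OF g])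
  ultimately have "((\<lambda>h. \<Prod>j\<in>UNIV. g j (h j)) has_sum (\<Prod>j\<in>UNIV. S j)) ?U"
    by (metis has_sum_infsum)
  moreover have "bij_betw vec_lambda ?U (UNIV :: (nat ^ 'd) set)"
    by (rule bij_betwI[where g = vec_nth]) auto
  ultimately show ?thesis
    using has_sum_reindex_bij_betw[of vec_lambda ?U UNIV "\<lambda>n. \<Prod>j\<in>UNIV. g j (n $ j)"] by simp
qed

lemma has_sum_vec:
  fixes f :: "'a \<Rightarrow> complex ^ 'd::finite"
  assumes "\<And>i. ((\<lambda>n. f n $ i) has_sum S $ i) A"
  shows "(f has_sum S) A"
  using assms unfolding has_sum_def by (intro vec_tendstoI) simp

lemma norm_less_1_has_sum_geometric:
  fixes x :: complex
  assumes "norm x < 1"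
  shows "((\<lambda>n. x ^ n) has_sum 1 / (1 - x)) UNIV"
    and "((\<lambda>n. of_nat n * x ^ n) has_sum x / (1 - x)\<^sup>2) UNIV"
proof -
  show "((\<lambda>n. x ^ n) has_sum 1 / (1 - x)) UNIV"
    using assms by (intro norm_summable_imp_has_sum geometric_sums) (simp add: norm_power summable_geometric)
  have sums: "(\<lambda>n. of_nat n * y ^ n) sums (y / (1 - y)\<^sup>2)" if "norm y < 1" for y :: "'a::{real_normed_field,banach}"
  proof -
    have "(\<lambda>n. y * (of_nat (Suc n) * y ^ n)) sums (y * (1 / (1 - y)\<^sup>2))"
      by (intro sums_mult geometric_deriv_sums that)
    then have "(\<lambda>n. of_nat (Suc n) * y ^ Suc n) sums (y / (1 - y)\<^sup>2)"
      by (simp add: mult_ac)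
    then show ?thesis
      using sums_Suc_iff[of "\<lambda>n. of_nat n * y ^ n"] by simp
  qed
  have "summable (\<lambda>n. norm (of_nat n * x ^ n))"
    using sums[of "norm x"] assms by (auto simp: norm_mult norm_power sums_iff)
  then show "((\<lambda>n. of_nat n * x ^ n) has_sum x / (1 - x)\<^sup>2) UNIV"
    using sums[OF assms] by (rule norm_summable_imp_has_sum)
qed

lemma has_sum_mpow:
  fixes v :: "complex ^ 'd::finite"
  assumes "v \<in> polydisc"
  shows "((\<lambda>n. mpow v n) has_sum (\<Prod>j\<in>UNIV. 1 / (1 - v $ j))) UNIV"
  using assms unfolding mpow_def polydisc_def
  by (intro has_sum_prod_vec norm_less_1_has_sum_geometric) auto

lemma has_sum_index_mpow:
  fixes v :: "complex ^ 'd::finite"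
  assumes v: "v \<in> polydisc"
  shows "((\<lambda>n. of_nat (n $ i) * mpow v n) has_sum
           (v $ i / ((1 - v $ i)\<^sup>2 * (\<Prod>l\<in>UNIV - {i}. 1 - v $ l)))) UNIV"
proof -
  let ?g = "\<lambda>j k. (if j = i then of_nat k else 1) * (v $ j) ^ k"
  let ?S = "\<lambda>j. if j = i then v $ j / (1 - v $ j)\<^sup>2 else 1 / (1 - v $ j)"
  have "((\<lambda>n. \<Prod>j\<in>UNIV. ?g j (n $ j)) has_sum (\<Prod>j\<in>UNIV. ?S j)) UNIV"
    using v norm_less_1_has_sum_geometric by (intro has_sum_prod_vec) (auto simp: polydisc_def)
  moreover have "(\<Prod>j\<in>UNIV. ?g j (n $ j)) = of_nat (n $ i) * mpow v n" for n
    by (simp add: prod.distrib mpow_def)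
  moreover have "(\<Prod>j\<in>UNIV. ?S j) = v $ i / ((1 - v $ i)\<^sup>2 * (\<Prod>l\<in>UNIV - {i}. 1 - v $ l))"
    by (subst prod.remove[of UNIV i]) (auto simp: prod_dividef)
  ultimately show ?thesis
    by simp
qed

lemma summable_on_growth_bound:
  fixes v :: "complex ^ 'd::finite" and c :: "nat ^ 'd \<Rightarrow> complex"
  assumes v: "v \<in> polydisc" and c: "\<And>n. norm (c n) \<le> a * real (n $ i) + b"
  shows "(\<lambda>n. c n * mpow v n) summable_on UNIV"
proof -
  have 1: "(\<lambda>n. norm (of_nat (n $ i) * mpow v n)) summable_on UNIV" "(\<lambda>n. norm (mpow v n)) summable_on UNIV"
    using has_sum_imp_summable[OF has_sum_index_mpow[OF v, of i]] has_sum_imp_summable[OF has_sum_mpow[OF v]]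
    by (simp_all only: summable_on_iff_abs_summable_on_complex)
  have "(\<lambda>n. norm (c n * mpow v n)) summable_on UNIV"
  proof (rule Infinite_Sum.abs_summable_on_comparison_test')
    show "(\<lambda>n. a * norm (of_nat (n $ i) * mpow v n) + b * norm (mpow v n)) summable_on UNIV"
      by (intro summable_on_add summable_on_cmult_right 1)
    show "norm (c n * mpow v n) \<le> a * norm (of_nat (n $ i) * mpow v n) + b * norm (mpow v n)" for n
      using mult_right_mono[OF c norm_ge_zero, of n "mpow v n"] by (simp add: norm_mult algebra_simps)
  qed
  then show ?thesis
    by (simp only: summable_on_iff_abs_summable_on_complex)
qed

lemma power_series_deriv_0I:
  assumes "\<And>v i. v \<in> polydisc \<Longrightarrow> ((\<lambda>n. c i n * mpow v n) has_sum f v $ i) UNIV"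
  shows "power_series_deriv c 0 f"
  using assms by (simp add: power_series_deriv_def dmpow_def dmon_0 mpow_def)

lemma power_series_deriv_0D:
  assumes "power_series_deriv c 0 f" "v \<in> polydisc"
  shows "((\<lambda>n. c i n * mpow v n) has_sum f v $ i) UNIV"
  using assms by (simp add: power_series_deriv_def dmpow_def dmon_0 mpow_def)

lemma gen_f_0:
  assumes "z \<in> polydisc"
  shows "gen_f t 0 z = (\<chi> j. z $ j / ((1 - z $ j)\<^sup>2 * (\<Prod>l\<in>UNIV - {j}. 1 - z $ l)))"
  unfolding gen_f_def using has_sum_index_mpow[OF assms]
  by (intro infsumI has_sum_vec) (simp add: cvec_def mult.commute)

text \<open>Coordinatewise instead of in a norm: under a diagonal matrix coordinate i of the image
  depends on coordinate i alone, so the explicit series of n_i z^n can serve as majorant.\<close>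

definition linear_growth :: "real \<Rightarrow> real \<Rightarrow> (nat ^ 'd::finite \<Rightarrow> nat ^ 'd) \<Rightarrow> bool" where
  "linear_growth K \<beta> t \<longleftrightarrow> (\<forall>n i. real (t n $ i) \<le> K * real (n $ i) + \<beta>)"

text \<open>Iteration gives K^k n_i + (1 + K + ... + K^(k-1)) beta, and K >= 1 bounds each of the k
  powers by K^k.\<close>

lemma linear_growth_funpow:
  assumes t: "linear_growth K \<beta> t" and "1 \<le> K" "0 \<le> \<beta>"
  shows "real ((t ^^ k) n $ i) \<le> K ^ k * real (n $ i) + real k * K ^ k * \<beta>"
proof (induction k)
  case (Suc k)
  have "real ((t ^^ Suc k) n $ i) \<le> K * real ((t ^^ k) n $ i) + \<beta>"
    using t by (simp add: linear_growth_def)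
  also have "\<dots> \<le> K * (K ^ k * real (n $ i) + real k * K ^ k * \<beta>) + K ^ Suc k * \<beta>"
    using Suc assms one_le_power[of K "Suc k"] mult_right_mono[of 1 "K ^ Suc k" \<beta>]
    by (intro add_mono mult_left_mono) (auto simp del: power_Suc)
  also have "\<dots> = K ^ Suc k * real (n $ i) + real (Suc k) * K ^ Suc k * \<beta>"
    by (simp add: algebra_simps)
  finally show ?case .
qed auto

lemma power_series_deriv_gen_f:
  fixes t :: "nat ^ 'd::finite \<Rightarrow> nat ^ 'd"
  assumes "linear_growth K \<beta> t" "1 \<le> K" "0 \<le> \<beta>"
  shows "power_series_deriv (\<lambda>i n. of_nat ((t ^^ k) n $ i)) 0 (gen_f t k)"
proof (rule power_series_deriv_0I)
  fix v :: "complex ^ 'd" and i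
  assume v: "v \<in> polydisc"
  have "(\<lambda>n. of_nat ((t ^^ k) n $ i) * mpow v n) summable_on UNIV" for i
    by (rule summable_on_growth_bound[OF v, of _ "K ^ k" i "real k * K ^ k * \<beta>"])
       (simp add: linear_growth_funpow[OF assms])
  then have "((\<lambda>n. mpow v n *s cvec ((t ^^ k) n)) has_sum
      (\<chi> i. \<Sum>\<^sub>\<infinity>n. of_nat ((t ^^ k) n $ i) * mpow v n)) UNIV"
    by (intro has_sum_vec) (simp add: cvec_def mult.commute)
  then have "gen_f t k v = (\<chi> i. \<Sum>\<^sub>\<infinity>n. of_nat ((t ^^ k) n $ i) * mpow v n)"
    unfolding gen_f_def by (rule infsumI)
  then show "((\<lambda>n. of_nat ((t ^^ k) n $ i) * mpow v n) has_sum gen_f t k v $ i) UNIV"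
    using \<open>\<And>i. (\<lambda>n. of_nat ((t ^^ k) n $ i) * mpow v n) summable_on UNIV\<close>[of i] by simp
qed

section \<open>Summation over the iterates\<close>

lemma summable_on_product_real:
  fixes a :: "'a \<Rightarrow> real" and b :: "'b \<Rightarrow> real"
  assumes "a summable_on A" "b summable_on B" "\<And>x. x \<in> A \<Longrightarrow> 0 \<le> a x" "\<And>y. y \<in> B \<Longrightarrow> 0 \<le> b y"
  shows "(\<lambda>(x, y). a x * b y) summable_on A \<times> B"
proof (rule summable_on_SigmaI)
  show "((\<lambda>y. case (x, y) of (x, y) \<Rightarrow> a x * b y) has_sum a x * infsum b B) B" for x
    using assms(2) by (simp add: has_sum_cmult_right)
  show "(\<lambda>x. a x * infsum b B) summable_on A"
    using assms(1) by (rule summable_on_cmult_left)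
qed (use assms in auto)

text \<open>Component i of the coefficient of z^n in F(z, w), with the sum over k moved
  inside.\<close>

definition orbit_series :: "(nat ^ 'd::finite \<Rightarrow> nat ^ 'd) \<Rightarrow> complex \<Rightarrow> 'd \<Rightarrow> nat ^ 'd \<Rightarrow> complex" where
  "orbit_series t w i n = (\<Sum>\<^sub>\<infinity>k. of_nat ((t ^^ k) n $ i) * w ^ k)"

text \<open>Each term of the majorant splits into a factor in n and a factor in k, so the double
  series can be compared with products of summable series.\<close>

lemma orbit_majorant:
  fixes t :: "nat ^ 'd::finite \<Rightarrow> nat ^ 'd" and w :: complex
  assumes t: "linear_growth K \<beta> t" and K: "1 \<le> K" "0 \<le> \<beta>"
  shows "norm (of_nat ((t ^^ k) n $ i) * w ^ k) \<le>
     real (n $ i) * (K * norm w) ^ k + \<beta> * (real k * (K * norm w) ^ k)"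
proof -
  have "norm (of_nat ((t ^^ k) n $ i) * w ^ k) = real ((t ^^ k) n $ i) * norm w ^ k"
    by (simp add: norm_mult norm_power)
  also have "\<dots> \<le> (K ^ k * real (n $ i) + real k * K ^ k * \<beta>) * norm w ^ k"
    by (intro mult_right_mono linear_growth_funpow[OF assms]) auto
  also have "\<dots> = real (n $ i) * (K * norm w) ^ k + \<beta> * (real k * (K * norm w) ^ k)"
    by (simp add: power_mult_distrib algebra_simps)
  finally show ?thesis .
qed

lemma geometric_summable_real:
  fixes q :: real
  assumes "0 \<le> q" "q < 1"
  shows "(\<lambda>k. q ^ k) summable_on UNIV" "(\<lambda>k. real k * q ^ k) summable_on UNIV"
proof -
  have "norm (complex_of_real q) < 1"
    using assms by simp
  from norm_less_1_has_sum_geometric[OF this, THEN has_sum_imp_summable]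
  have "(\<lambda>k. norm (complex_of_real q ^ k)) summable_on UNIV"
    "(\<lambda>k. norm (of_nat k * complex_of_real q ^ k)) summable_on UNIV"
    by (simp_all only: summable_on_iff_abs_summable_on_complex)
  then show "(\<lambda>k. q ^ k) summable_on UNIV" "(\<lambda>k. real k * q ^ k) summable_on UNIV"
    using assms by (simp_all add: norm_mult norm_power)
qed

lemma orbit_series_has_sum:
  assumes "linear_growth K \<beta> t" "1 \<le> K" "0 \<le> \<beta>" "K * norm w < 1"
  shows "((\<lambda>k. of_nat ((t ^^ k) n $ i) * w ^ k) has_sum orbit_series t w i n) UNIV"
proof -
  have "(\<lambda>k. norm (of_nat ((t ^^ k) n $ i) * w ^ k)) summable_on UNIV"
    by (rule Infinite_Sum.abs_summable_on_comparison_test'[OF _ orbit_majorant[OF assms(1-3)]])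
       (intro summable_on_add summable_on_cmult_right geometric_summable_real; use assms in simp)
  then show ?thesis
    unfolding orbit_series_def by (intro has_sum_infsum) (simp only: summable_on_iff_abs_summable_on_complex)
qed

text \<open>The term k = 0 is split off and the others are shifted, since
  \<open>(t ^^ Suc k) n = (t ^^ k) (t n)\<close>. This is the functional equation of F on the level
  of coefficients.\<close>

lemma orbit_series_rec:
  assumes "linear_growth K \<beta> t" "1 \<le> K" "0 \<le> \<beta>" "K * norm w < 1"
  shows "orbit_series t w i n = of_nat (n $ i) + w * orbit_series t w i (t n)"
proof -
  let ?a = "\<lambda>k. of_nat ((t ^^ k) n $ i) * w ^ k"
  have "((\<lambda>k. w * (of_nat ((t ^^ k) (t n) $ i) * w ^ k)) has_sum w * orbit_series t w i (t n)) UNIV"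
    by (intro has_sum_cmult_right orbit_series_has_sum[OF assms])
  then have "((\<lambda>k. ?a (Suc k)) has_sum w * orbit_series t w i (t n)) UNIV"
    by (simp add: funpow_swap1 mult_ac)
  then have "(?a has_sum w * orbit_series t w i (t n)) (range Suc)"
    by (subst has_sum_reindex) (auto simp: o_def)
  then have "(?a has_sum (?a 0 + w * orbit_series t w i (t n))) (insert 0 (range Suc))"
    by (intro has_sum_insert) auto
  moreover have "insert 0 (range Suc) = UNIV"
    by (metis UNIV_nat_eq)
  ultimately have "(?a has_sum (of_nat (n $ i) + w * orbit_series t w i (t n))) UNIV"
    by simp
  then show ?thesis
    using orbit_series_has_sum[OF assms] has_sum_unique by blast
qed

text \<open>\<open>gen_F\<close> has the sum over n inside and that over k outside; a power series
  in z needs the opposite order. Summability on the product set, from the separated majorant,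
  justifies the exchange.\<close>

lemma power_series_deriv_gen_F:
  fixes t :: "nat ^ 'd::finite \<Rightarrow> nat ^ 'd"
  assumes t: "linear_growth K \<beta> t" "1 \<le> K" "0 \<le> \<beta>" and w: "K * norm w < 1"
  shows "power_series_deriv (orbit_series t w) 0 (\<lambda>v. gen_F t v w)"
proof (rule power_series_deriv_0I)
  fix v :: "complex ^ 'd" and i
  assume v: "v \<in> polydisc"
  let ?q = "K * norm w"
  let ?h = "\<lambda>i (k, n). of_nat ((t ^^ k) n $ i) * w ^ k * mpow v n"
  have q: "0 \<le> ?q" "?q < 1"
    using t w by auto
  have 1: "(\<lambda>n. norm (of_nat (n $ i) * mpow v n)) summable_on UNIV" "(\<lambda>n. norm (mpow v n)) summable_on UNIV" for i
    using has_sum_imp_summable[OF has_sum_index_mpow[OF v, of i]] has_sum_imp_summable[OF has_sum_mpow[OF v]]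
    by (simp_all only: summable_on_iff_abs_summable_on_complex)
  have "(\<lambda>p. norm (?h i p)) summable_on UNIV \<times> UNIV" for i
  proof (rule Infinite_Sum.abs_summable_on_comparison_test')
    show "(\<lambda>p. (case p of (k, n) \<Rightarrow> ?q ^ k * norm (of_nat (n $ i) * mpow v n)) +
       \<beta> * (case p of (k, n) \<Rightarrow> (real k * ?q ^ k) * norm (mpow v n))) summable_on UNIV \<times> UNIV"
      by (intro summable_on_add summable_on_cmult_right summable_on_product_real 1 geometric_summable_real q)
         (use q in auto)
    show "norm (?h i p) \<le> (case p of (k, n) \<Rightarrow> ?q ^ k * norm (of_nat (n $ i) * mpow v n)) +
       \<beta> * (case p of (k, n) \<Rightarrow> (real k * ?q ^ k) * norm (mpow v n))" for p
    proof (cases p)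
      case (Pair k n)
      have "norm (?h i p) \<le> (real (n $ i) * ?q ^ k + \<beta> * (real k * ?q ^ k)) * norm (mpow v n)"
        unfolding Pair prod.case norm_mult[of _ "mpow v n"]
        by (rule mult_right_mono[OF orbit_majorant[OF t] norm_ge_zero])
      also have "\<dots> = ?q ^ k * norm (of_nat (n $ i) * mpow v n) + \<beta> * ((real k * ?q ^ k) * norm (mpow v n))"
        by (simp add: norm_mult algebra_simps)
      finally show ?thesis
        by (simp add: Pair)
    qed
  qed
  then have summ: "?h i summable_on UNIV \<times> UNIV" for i
    by (simp only: summable_on_iff_abs_summable_on_complex)
  define S where "S = (\<lambda>i. infsum (?h i) (UNIV \<times> UNIV))"
  have S: "(?h i has_sum S i) (UNIV \<times> UNIV)" for i
    unfolding S_def by (rule has_sum_infsum[OF summ])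
  have inner: "((\<lambda>n. ?h i (k, n)) has_sum (\<Sum>\<^sub>\<infinity>n. ?h i (k, n))) UNIV" for i k
    by (rule has_sum_infsum) (use summable_on_SigmaD1[OF summ[of i] UNIV_I, of k] in simp)
  have "(\<Sum>\<^sub>\<infinity>n. (mpow v n * w ^ k) *s cvec ((t ^^ k) n)) = (\<chi> i. \<Sum>\<^sub>\<infinity>n. ?h i (k, n))" for k
    by (rule infsumI, rule has_sum_vec) (use inner in \<open>simp add: cvec_def mult_ac\<close>)
  moreover have "((\<lambda>k. \<Sum>\<^sub>\<infinity>n. ?h i (k, n)) has_sum S i) UNIV" for i
    by (rule has_sum_SigmaD[OF S inner])
  then have "((\<lambda>k. \<chi> i. \<Sum>\<^sub>\<infinity>n. ?h i (k, n)) has_sum (\<chi> i. S i)) UNIV"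
    by (intro has_sum_vec) simp
  ultimately have F: "gen_F t v w = (\<chi> i. S i)"
    unfolding gen_F_def by (simp add: infsumI)
  have "((\<lambda>(n, k). ?h i (k, n)) has_sum S i) (UNIV \<times> UNIV)"
    using S has_sum_swap by blast
  then have "((\<lambda>n. orbit_series t w i n * mpow v n) has_sum S i) UNIV"
    by (rule has_sum_SigmaD) (use has_sum_cmult_left[OF orbit_series_has_sum[OF t w]] in simp)
  then show "((\<lambda>n. orbit_series t w i n * mpow v n) has_sum gen_F t v w $ i) UNIV"
    by (simp add: F)
qed

lemma collatz_linear_growth:
  fixes m :: "nat ^ 'd::finite"
  assumes m: "\<forall>j. 0 < m $ j" and t: "is_collatz_map m A b t"
    and diag: "\<forall>r\<in>residue_box m. \<forall>i j. i \<noteq> j \<longrightarrow> A r $ i $ j = 0"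
  obtains \<beta> where "0 \<le> \<beta>" "linear_growth (max (family_max_norm m A) 1) \<beta> t"
proof
  \<comment> \<open>A crude bound for all entries of all \<open>b r\<close> at once. The maximum
    with 1 in the other constant provides the condition K >= 1 of
    \<open>linear_growth_funpow\<close>.\<close>
  let ?\<beta> = "\<Sum>r\<in>residue_box m. \<Sum>i\<in>UNIV. norm (b r $ i)"
  show "0 \<le> ?\<beta>"
    by (intro sum_nonneg) auto
  show "linear_growth (max (family_max_norm m A) 1) ?\<beta> t"
    unfolding linear_growth_def
  proof (intro allI)
    fix n i
    define r where "r = (\<chi> j. n $ j mod m $ j)"
    have r: "r \<in> residue_box m"
      using m by (simp add: r_def residue_box_def)
    have "{norm (A r $ i $ j) |r i j. r \<in> residue_box m} \<subseteq>
        (\<lambda>(r, i, j). norm (A r $ i $ j)) ` (residue_box m \<times> UNIV \<times> UNIV)"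
    proof
      fix x assume "x \<in> {norm (A r $ i $ j) |r i j. r \<in> residue_box m}"
      then obtain r i j where "x = norm (A r $ i $ j)" "r \<in> residue_box m"
        by blast
      then show "x \<in> (\<lambda>(r, i, j). norm (A r $ i $ j)) ` (residue_box m \<times> UNIV \<times> UNIV)"
        by (intro image_eqI[of _ _ "(r, i, j)"]) auto
    qed
    then have "finite {norm (A r $ i $ j) |r i j. r \<in> residue_box m}"
      by (rule finite_subset) (intro finite_imageI finite_cartesian_product finite_residue_box finite)
    then have A: "norm (A r $ i $ i) \<le> family_max_norm m A"
      unfolding family_max_norm_def using r by (intro Max_ge) auto
    have "norm (b r $ i) \<le> (\<Sum>i\<in>UNIV. norm (b r $ i))"
      by (rule member_le_sum) auto
    also have "\<dots> \<le> ?\<beta>"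
      using r by (intro member_le_sum[where f = "\<lambda>r. \<Sum>i\<in>UNIV. norm (b r $ i)"] finite_residue_box sum_nonneg) auto
    finally have b: "norm (b r $ i) \<le> ?\<beta>" .
    have eq: "cvec (t n) = A r *v cvec n + b r"
      using t r by (auto simp: is_collatz_map_def cong_def r_def)
    have "(A r *v cvec n) $ i = A r $ i $ i * of_nat (n $ i)"
      unfolding matrix_vector_mult_def using diag r by (simp add: sum.remove[of UNIV i] cvec_def)
    then have "of_nat (t n $ i) = A r $ i $ i * of_nat (n $ i) + b r $ i"
      using arg_cong[OF eq, of "\<lambda>v. v $ i"] by (simp add: cvec_def)
    then have "real (t n $ i) = norm (A r $ i $ i * of_nat (n $ i) + b r $ i)"
      by (metis norm_of_nat)
    also have "\<dots> \<le> norm (A r $ i $ i) * real (n $ i) + norm (b r $ i)"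
      using norm_triangle_ineq[of "A r $ i $ i * of_nat (n $ i)" "b r $ i"] by (simp add: norm_mult)
    also have "\<dots> \<le> max (family_max_norm m A) 1 * real (n $ i) + ?\<beta>"
      using A b by (intro add_mono mult_right_mono) auto
    finally show "real (t n $ i) \<le> max (family_max_norm m A) 1 * real (n $ i) + ?\<beta>" .
  qed
qed

text \<open>Turns the radius into K |w| < 1, the convergence condition of the orbit series with the
  constant K of \<open>collatz_linear_growth\<close>. The two members of the minimum answer to the
  two cases of the maximum.\<close>

lemma R_w_bound:
  fixes A :: "nat ^ 'd \<Rightarrow> complex ^ 'd ^ 'd::finite"
  assumes "norm w < R_w m A"
  shows "max (family_max_norm m A) 1 * norm w < 1"
proof (cases "family_max_norm m A \<le> 1")
  case True
  then show ?thesis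
    using assms by (simp add: R_w_def max_def)
next
  case False
  let ?M = "family_max_norm m A"
  have d: "1 \<le> real CARD('d)"
    by (simp add: Suc_le_eq)
  have "norm w * (real CARD('d) * ?M) < 1"
    using assms False d by (simp add: R_w_def field_simps)
  moreover have "norm w * ?M \<le> norm w * (real CARD('d) * ?M)"
    using d False by (intro mult_left_mono) auto
  ultimately show ?thesis
    using False by (simp add: mult.commute max_def)
qed

subsection \<open>The recursions\<close>

lemma collatz_functional_recurrence:
  fixes m :: "nat ^ 'd::finite" and z :: "complex ^ 'd"
  assumes m: "\<forall>j. 0 < m $ j" and lam: "\<And>r. r \<in> residue_box m \<Longrightarrow> \<forall>j. 0 < lam r $ j"
    and t: "\<And>r q. r \<in> residue_box m \<Longrightarrow> t (r + m * q) = mu r + lam r * q"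
    and mo: "\<And>r. r \<in> residue_box m \<Longrightarrow>
      multiplies_out m (lam r) (mu r) (pf_sigmas m (lam r) (mu r)) (pf_taus m (lam r) (mu r)) (L r) (\<eta> r) (\<phi> r)"
    and z: "z \<in> punctured_polydisc" and f: "power_series_deriv c 0 f"
  shows "((\<lambda>n. mpow z n * c i (t n)) has_sum
     (\<Sum>r\<in>residue_box m. mpow z r *s
        (\<Sum>(l, \<nu>)\<in>L r. (\<eta> r (l, \<nu>) z / mfact l) *s mixed_deriv l f (\<phi> r (l, \<nu>) z))) $ i) UNIV"
proof -
  have "((\<lambda>n. c i n * pf_moments m (lam r) (mu r) z n) has_sum
      (\<Sum>(l, \<nu>)\<in>L r. (\<eta> r (l, \<nu>) z / mfact l) *s mixed_deriv l f (\<phi> r (l, \<nu>) z)) $ i) UNIV"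
    if "r \<in> residue_box m" for r
    by (rule multiplies_out_has_sum_moments[OF mo z m lam f]) (rule that)+
  from has_sum_collatz[where t = t, OF m lam t this] show ?thesis
    by simp
qed

lemma collatz_torus_recursion:
  fixes m :: "nat ^ 'd::finite" and z :: "complex ^ 'd"
  assumes m: "\<forall>j. 0 < m $ j" and lam: "\<And>r. r \<in> residue_box m \<Longrightarrow> \<forall>j. 0 < lam r $ j"
    and t: "\<And>r q. r \<in> residue_box m \<Longrightarrow> t (r + m * q) = mu r + lam r * q"
    and \<rho>: "\<And>j. norm (z $ j) powr (real (m $ j) / real (Max ((\<lambda>r. lam r $ j) ` residue_box m))) < \<rho> $ j"
      "\<And>j. \<rho> $ j < 1"
    and z: "z \<in> punctured_polydisc" and f: "power_series_deriv c 0 f"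
  shows "((\<lambda>n. mpow z n * c i (t n)) has_sum
     (\<Sum>r\<in>residue_box m. (mpow z r / (2 * pi * \<i>) ^ CARD('d)) *s
        torus_integral \<rho> (\<lambda>u. (\<Prod>j\<in>UNIV. pf_kernel (m $ j) (lam r $ j) (mu r $ j) (z $ j) (u $ j)) *s f u)) $ i) UNIV"
proof -
  let ?K = "\<lambda>r j. pf_kernel (m $ j) (lam r $ j) (mu r $ j) (z $ j)"
  let ?T = "\<lambda>r. torus_integral \<rho> (\<lambda>u. (\<Prod>j\<in>UNIV. ?K r j (u $ j)) *s f u)"
  let ?C = "(2 * pi * \<i>) ^ CARD('d) :: complex"
  have zj: "z $ j \<noteq> 0" "norm (z $ j) < 1" for j
    using z by (auto simp: punctured_polydisc_def)
  have \<rho>0: "0 < \<rho> $ j" for j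
    using \<rho>(1)[of j] by (meson le_less_trans powr_ge_zero)
  have "((\<lambda>n. c i n * pf_moments m (lam r) (mu r) z n) has_sum ?T r $ i / ?C) UNIV" if r: "r \<in> residue_box m" for r
  proof -
    \<comment> \<open>One poly-radius serves all residues: passing from the maximal lam to
      \<open>lam r\<close> enlarges the exponent, and for a base below 1 this makes the power
      smaller.\<close>
    have lt: "norm (z $ j) powr (real (m $ j) / real (lam r $ j)) < \<rho> $ j" for j
    proof -
      have "lam r $ j \<le> Max ((\<lambda>r. lam r $ j) ` residue_box m)"
        using r finite_residue_box by (intro Max_ge) auto
      then have "real (m $ j) / real (Max ((\<lambda>r. lam r $ j) ` residue_box m)) \<le> real (m $ j) / real (lam r $ j)"
        using lam[OF r, rule_format, of j] by (intro divide_left_mono mult_pos_pos) auto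
      then have "norm (z $ j) powr (real (m $ j) / real (lam r $ j)) \<le>
          norm (z $ j) powr (real (m $ j) / real (Max ((\<lambda>r. lam r $ j) ` residue_box m)))"
        using zj(2)[of j] by (intro powr_mono') auto
      then show ?thesis
        using \<rho>(1)[of j] by linarith
    qed
    note kernel = has_contour_integral_pf_kernel[OF zj(1) lam[OF r, rule_format] lt]
    have "((\<lambda>n. c i n * (\<Prod>j\<in>UNIV. contour_integral (circlepath 0 (\<rho> $ j)) (\<lambda>u. ?K r j u * u ^ (n $ j))))
        has_sum ?T r $ i) UNIV"
      by (intro torus_integral_has_sum f \<rho>0 \<rho>(2) kernel(1))
    moreover have "(\<Prod>j\<in>UNIV. contour_integral (circlepath 0 (\<rho> $ j)) (\<lambda>u. ?K r j u * u ^ (n $ j))) =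
        ?C * pf_moments m (lam r) (mu r) z n" for n
      unfolding kernel(2) pf_moments_def by (simp add: prod.distrib)
    ultimately have "((\<lambda>n. inverse ?C * (c i n * (?C * pf_moments m (lam r) (mu r) z n))) has_sum inverse ?C * ?T r $ i) UNIV"
      by (intro has_sum_cmult_right) simp
    moreover have "(c i n * (?C * x)) * inverse ?C = c i n * x" for n x
      by (simp add: field_simps)
    ultimately show ?thesis
      by (simp only: divide_inverse mult.commute[of "inverse ?C"])
  qed
  from has_sum_collatz[where t = t, OF m lam t this] show ?thesis
    by simp
qed

theorem theorem2p2:
  fixes m :: "nat ^ 'd::finite"
    and A :: "nat ^ 'd \<Rightarrow> complex ^ 'd ^ 'd"
    and b :: "nat ^ 'd \<Rightarrow> complex ^ 'd"
    and lam mu :: "nat ^ 'd \<Rightarrow> nat ^ 'd"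
    and t :: "nat ^ 'd \<Rightarrow> nat ^ 'd"
  assumes m_pos: "\<forall>j. 0 < m $ j"
    and C2a: "\<forall>r\<in>residue_box m. A r *v cvec m = cvec (lam r) \<and> (\<forall>j. 0 < lam r $ j)"
    and C2b: "\<forall>r\<in>residue_box m. A r *v cvec r + b r = cvec (mu r)"
    and t: "is_collatz_map m A b t"
  shows "\<exists>(\<sigma> :: nat ^ 'd \<Rightarrow> 'd \<Rightarrow> nat \<Rightarrow> complex \<Rightarrow> complex)
          (\<tau> :: nat ^ 'd \<Rightarrow> 'd \<Rightarrow> nat \<Rightarrow> complex \<Rightarrow> complex)
          (L :: nat ^ 'd \<Rightarrow> ((nat ^ 'd) \<times> nat) set)
          (\<eta> :: nat ^ 'd \<Rightarrow> (nat ^ 'd) \<times> nat \<Rightarrow> complex ^ 'd \<Rightarrow> complex)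
          (\<phi> :: nat ^ 'd \<Rightarrow> (nat ^ 'd) \<times> nat \<Rightarrow> complex ^ 'd \<Rightarrow> complex ^ 'd).
    \<comment> \<open>(S2.a): the coefficients of the one-variable decompositions exist and are unique\<close>
    (\<forall>r\<in>residue_box m. \<forall>z\<in>punctured_polydisc. \<forall>j.
       is_partial_fraction (m $ j) (lam r $ j) (mu r $ j) (z $ j)
         (\<lambda>l. \<sigma> r j l (z $ j)) (\<lambda>l. \<tau> r j l (z $ j)) \<and>
       (\<forall>\<sigma>' \<tau>'. is_partial_fraction (m $ j) (lam r $ j) (mu r $ j) (z $ j) \<sigma>' \<tau>' \<longrightarrow>
          (\<forall>l < Suc (mu r $ j) - lam r $ j. \<sigma>' l = \<sigma> r j l (z $ j)) \<and>
          (\<forall>l < lam r $ j. \<tau>' l = \<tau> r j l (z $ j)))) \<and>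
    \<comment> \<open>(S2.a): the multiplied-out sum, unique up to the numbering \<open>\<nu>\<close>\<close>
    (\<forall>r\<in>residue_box m.
       finite (L r) \<and> L r \<noteq> {} \<and> (0, 0) \<in> L r \<and>
       multiplies_out m (lam r) (mu r) (\<sigma> r) (\<tau> r) (L r) (\<eta> r) (\<phi> r) \<and>
       (\<forall>L' \<eta>' \<phi>'. multiplies_out m (lam r) (mu r) (\<sigma> r) (\<tau> r) L' \<eta>' \<phi>' \<longrightarrow>
          (\<exists>g. bij_betw g L' (L r) \<and>
             (\<forall>p\<in>L'. fst (g p) = fst p \<and>
                (\<forall>z\<in>punctured_polydisc. \<eta>' p z = \<eta> r (g p) z \<and> \<phi>' p z = \<phi> r (g p) z))))) \<and>
    \<comment> \<open>(S2.a): the chain of equalities\<close>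
    (\<forall>r\<in>residue_box m. \<forall>z\<in>punctured_polydisc. \<forall>u :: complex ^ 'd.
       (\<forall>j. u $ j \<noteq> 0 \<and> (u $ j) ^ (lam r $ j) \<noteq> (z $ j) ^ (m $ j)) \<longrightarrow>
       (\<Prod>j\<in>UNIV. pf_kernel (m $ j) (lam r $ j) (mu r $ j) (z $ j) (u $ j)) =
       (\<Prod>j\<in>UNIV. 1 / ((u $ j) powi (int (mu r $ j) - int (lam r $ j) + 1) *
                       (\<Prod>l<lam r $ j. u $ j - root_phi (m $ j) (lam r $ j) l (z $ j)))) \<and>
       (\<Prod>j\<in>UNIV. 1 / ((u $ j) powi (int (mu r $ j) - int (lam r $ j) + 1) *
                       (\<Prod>l<lam r $ j. u $ j - root_phi (m $ j) (lam r $ j) l (z $ j)))) =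
       (\<Prod>j\<in>UNIV. pf_sum (m $ j) (lam r $ j) (mu r $ j)
                    (\<lambda>l. \<sigma> r j l (z $ j)) (\<lambda>l. \<tau> r j l (z $ j)) (z $ j) (u $ j)) \<and>
       (\<Prod>j\<in>UNIV. pf_sum (m $ j) (lam r $ j) (mu r $ j)
                    (\<lambda>l. \<sigma> r j l (z $ j)) (\<lambda>l. \<tau> r j l (z $ j)) (z $ j) (u $ j)) =
       (\<Sum>(l, \<nu>)\<in>L r. \<eta> r (l, \<nu>) z / mpow (u - \<phi> r (l, \<nu>) z) (l + 1))) \<and>
    \<comment> \<open>(S2.b): the initial condition\<close>
    (\<forall>z\<in>polydisc. gen_f t 0 z =
       (\<chi> j. z $ j / ((1 - z $ j)\<^sup>2 * (\<Prod>l\<in>UNIV - {j}. 1 - z $ l)))) \<and>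
    \<comment> \<open>The recursions are false unless all the matrices are diagonal.\<close>
    ((\<forall>r\<in>residue_box m. \<forall>i j. i \<noteq> j \<longrightarrow> A r $ i $ j = 0) \<longrightarrow>
      \<comment> \<open>(S2.b): contour-integral recursion\<close>
      (\<forall>z\<in>punctured_polydisc. \<forall>k\<ge>1. \<forall>\<rho> :: real ^ 'd.
         (\<forall>j. norm (z $ j) powr (real (m $ j) / real (Max ((\<lambda>r. lam r $ j) ` residue_box m))) < \<rho> $ j
              \<and> \<rho> $ j < 1) \<longrightarrow>
         gen_f t k z =
         (\<Sum>r\<in>residue_box m. (mpow z r / (2 * pi * \<i>) ^ CARD('d)) *s
            torus_integral \<rho> (\<lambda>u.
              (\<Prod>j\<in>UNIV. pf_kernel (m $ j) (lam r $ j) (mu r $ j) (z $ j) (u $ j)) *s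
              gen_f t (k - 1) u))) \<and>
      \<comment> \<open>(S2.b): functional recurrence\<close>
      (\<forall>z\<in>punctured_polydisc. \<forall>k\<ge>1.
         gen_f t k z =
         (\<Sum>r\<in>residue_box m. mpow z r *s
            (\<Sum>(l, \<nu>)\<in>L r. (\<eta> r (l, \<nu>) z / mfact l) *s
               mixed_deriv l (gen_f t (k - 1)) (\<phi> r (l, \<nu>) z)))) \<and>
      \<comment> \<open>(S2.c)\<close>
      (\<forall>z\<in>punctured_polydisc. \<forall>w. norm w < R_w m A \<longrightarrow>
         gen_F t z w = gen_f t 0 z + w *s
         (\<Sum>r\<in>residue_box m. mpow z r *s
            (\<Sum>(l, \<nu>)\<in>L r. (\<eta> r (l, \<nu>) z / mfact l) *s
               mixed_deriv l (\<lambda>v. gen_F t v w) (\<phi> r (l, \<nu>) z)))))"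
proof -
  define \<sigma> where "\<sigma> = (\<lambda>r. pf_sigmas m (lam r) (mu r))"
  define \<tau> where "\<tau> = (\<lambda>r. pf_taus m (lam r) (mu r))"
  have lam: "\<forall>j. 0 < lam r $ j" if "r \<in> residue_box m" for r
    using C2a that by blast
  have "\<forall>r\<in>residue_box m. \<exists>L \<eta> \<phi>. finite L \<and> (0, 0) \<in> L \<and>
      multiplies_out m (lam r) (mu r) (\<sigma> r) (\<tau> r) L \<eta> \<phi>"
    using ex_multiplies_out[OF lam] by blast
  then obtain L \<eta> \<phi> where L: "\<And>r. r \<in> residue_box m \<Longrightarrow> finite (L r) \<and> (0, 0) \<in> L r"
    and mo: "\<And>r. r \<in> residue_box m \<Longrightarrow> multiplies_out m (lam r) (mu r) (\<sigma> r) (\<tau> r) (L r) (\<eta> r) (\<phi> r)"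
    by metis
  have pf: "is_partial_fraction (m $ j) (lam r $ j) (mu r $ j) (z $ j)
      (\<lambda>l. \<sigma> r j l (z $ j)) (\<lambda>l. \<tau> r j l (z $ j))"
    if "r \<in> residue_box m" "z \<in> punctured_polydisc" for r z j
    using is_partial_fraction_sigma_tau[of "z $ j" "lam r $ j"] lam that
    by (auto simp: \<sigma>_def \<tau>_def pf_sigmas_def pf_taus_def punctured_polydisc_def)
  show ?thesis
  proof (rule exI[of _ \<sigma>], rule exI[of _ \<tau>], rule exI[of _ L], rule exI[of _ \<eta>], rule exI[of _ \<phi>],
      intro conjI, goal_cases)
    case 1
    show ?case
    proof (intro ballI allI conjI impI)
      fix r z j \<sigma>' \<tau>' l
      assume r: "r \<in> residue_box m" and z: "z \<in> (punctured_polydisc :: (complex ^ 'd) set)"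
      show "is_partial_fraction (m $ j) (lam r $ j) (mu r $ j) (z $ j) (\<lambda>l. \<sigma> r j l (z $ j)) (\<lambda>l. \<tau> r j l (z $ j))"
        by (rule pf[OF r z])
      assume pf': "is_partial_fraction (m $ j) (lam r $ j) (mu r $ j) (z $ j) \<sigma>' \<tau>'"
      have "z $ j \<noteq> 0" "0 < lam r $ j"
        using z lam[OF r] by (auto simp: punctured_polydisc_def)
      note unique = partial_fraction_unique[OF this pf[OF r z] pf']
      show "\<sigma>' l = \<sigma> r j l (z $ j)" if "l < Suc (mu r $ j) - lam r $ j"
        using unique(1) that by blast
      show "\<tau>' l = \<tau> r j l (z $ j)" if "l < lam r $ j"
        using unique(2) that by blast
    qed
  next
    case 2
    show ?case
    proof (intro ballI allI conjI impI)
      fix r assume r: "r \<in> residue_box m"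
      show "finite (L r)" "L r \<noteq> {}" "(0, 0) \<in> L r"
        using L[OF r] by auto
      show "multiplies_out m (lam r) (mu r) (\<sigma> r) (\<tau> r) (L r) (\<eta> r) (\<phi> r)"
        by (rule mo[OF r])
      fix L' \<eta>' \<phi>'
      assume "multiplies_out m (lam r) (mu r) (\<sigma> r) (\<tau> r) L' \<eta>' \<phi>'"
      with mo[OF r] show "\<exists>g. bij_betw g L' (L r) \<and> (\<forall>p\<in>L'. fst (g p) = fst p \<and>
          (\<forall>z\<in>punctured_polydisc. \<eta>' p z = \<eta> r (g p) z \<and> \<phi>' p z = \<phi> r (g p) z))"
        by (rule multiplies_out_unique)
    qed
  next
    case 3
    show ?case
    proof (intro ballI allI impI)
      fix r and z u :: "complex ^ 'd"
      assume r: "r \<in> residue_box m" and z: "z \<in> punctured_polydisc"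
        and u: "\<forall>j. u $ j \<noteq> 0 \<and> (u $ j) ^ (lam r $ j) \<noteq> (z $ j) ^ (m $ j)"
      have z0: "z $ j \<noteq> 0" for j
        using z by (auto simp: punctured_polydisc_def)
      let ?A = "\<Prod>j\<in>UNIV. pf_kernel (m $ j) (lam r $ j) (mu r $ j) (z $ j) (u $ j)"
      let ?B = "\<Prod>j\<in>UNIV. 1 / ((u $ j) powi (int (mu r $ j) - int (lam r $ j) + 1) *
                       (\<Prod>l<lam r $ j. u $ j - root_phi (m $ j) (lam r $ j) l (z $ j)))"
      let ?C = "\<Prod>j\<in>UNIV. pf_sum (m $ j) (lam r $ j) (mu r $ j)
                    (\<lambda>l. \<sigma> r j l (z $ j)) (\<lambda>l. \<tau> r j l (z $ j)) (z $ j) (u $ j)"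
      have "?A = ?B"
        using prod_root_phi[OF z0] lam[OF r] by (simp add: pf_kernel_def)
      moreover have "?A = ?C"
        using pf[OF r z] u by (intro prod.cong refl) (simp add: is_partial_fraction_def)
      moreover have "?C = (\<Sum>(l, \<nu>)\<in>L r. \<eta> r (l, \<nu>) z / mpow (u - \<phi> r (l, \<nu>) z) (l + 1))"
        by (rule prod_pf_sum_multiplies_out[OF mo[OF r] z])
      ultimately show "?A = ?B \<and> ?B = ?C \<and>
          ?C = (\<Sum>(l, \<nu>)\<in>L r. \<eta> r (l, \<nu>) z / mpow (u - \<phi> r (l, \<nu>) z) (l + 1))"
        by simp
    qed
  next
    case 4
    show ?case
      by (intro ballI gen_f_0)
  next
    case 5
    show ?case
    proof (rule impI)
      assume diag: "\<forall>r\<in>residue_box m. \<forall>i j. i \<noteq> j \<longrightarrow> A r $ i $ j = 0"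
      \<comment> \<open>Diagonality is used for this affine form and for the growth bound
        below.\<close>
      have affine: "t (r + m * q) = mu r + lam r * q" if r: "r \<in> residue_box m" for r q
        using C2a C2b diag r by (intro collatz_map_residue_class[OF _ _ t r]) auto
      obtain \<beta> where "0 \<le> \<beta>" "linear_growth (max (family_max_norm m A) 1) \<beta> t"
        using collatz_linear_growth[OF m_pos t diag] by blast
      then have growth: "linear_growth (max (family_max_norm m A) 1) \<beta> t"
          "1 \<le> max (family_max_norm m A) 1" "0 \<le> \<beta>"
        by auto
      note f_series = power_series_deriv_gen_f[OF growth]
      note recurrence = collatz_functional_recurrence[OF m_pos lam affine mo[unfolded \<sigma>_def \<tau>_def]]
      have poly: "z \<in> polydisc" if "z \<in> punctured_polydisc" for z :: "complex ^ 'd"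
        using that by (auto simp: punctured_polydisc_def polydisc_def)
      \<comment> \<open>The coefficients of f_k are those of f_(k-1) taken at \<open>t n\<close>,
        which is the shape \<open>c i (t n)\<close> summed by both recursions.\<close>
      have f_step: "((\<lambda>n. mpow z n * of_nat ((t ^^ (k - 1)) (t n) $ i)) has_sum gen_f t k z $ i) UNIV"
        if "z \<in> punctured_polydisc" "k \<ge> 1" for z k i
      proof -
        have "(t ^^ k) n = (t ^^ (k - 1)) (t n)" for n
          using that(2) by (cases k) (simp_all add: funpow_swap1)
        then show ?thesis
          using power_series_deriv_0D[OF f_series[of k] poly[OF that(1)], of i] by (simp add: mult.commute)
      qed
      show "(\<forall>z\<in>punctured_polydisc. \<forall>k\<ge>1. \<forall>\<rho> :: real ^ 'd.
         (\<forall>j. norm (z $ j) powr (real (m $ j) / real (Max ((\<lambda>r. lam r $ j) ` residue_box m))) < \<rho> $ j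
              \<and> \<rho> $ j < 1) \<longrightarrow>
         gen_f t k z =
         (\<Sum>r\<in>residue_box m. (mpow z r / (2 * pi * \<i>) ^ CARD('d)) *s
            torus_integral \<rho> (\<lambda>u.
              (\<Prod>j\<in>UNIV. pf_kernel (m $ j) (lam r $ j) (mu r $ j) (z $ j) (u $ j)) *s
              gen_f t (k - 1) u))) \<and>
        (\<forall>z\<in>punctured_polydisc. \<forall>k\<ge>1.
         gen_f t k z =
         (\<Sum>r\<in>residue_box m. mpow z r *s
            (\<Sum>(l, \<nu>)\<in>L r. (\<eta> r (l, \<nu>) z / mfact l) *s
               mixed_deriv l (gen_f t (k - 1)) (\<phi> r (l, \<nu>) z)))) \<and>
        (\<forall>z\<in>punctured_polydisc. \<forall>w. norm w < R_w m A \<longrightarrow>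
         gen_F t z w = gen_f t 0 z + w *s
         (\<Sum>r\<in>residue_box m. mpow z r *s
            (\<Sum>(l, \<nu>)\<in>L r. (\<eta> r (l, \<nu>) z / mfact l) *s
               mixed_deriv l (\<lambda>v. gen_F t v w) (\<phi> r (l, \<nu>) z))))"
      proof (intro conjI ballI allI impI)
        fix z :: "complex ^ 'd" and k :: nat and \<rho> :: "real ^ 'd"
        assume z: "z \<in> punctured_polydisc" and k: "1 \<le> k"
          and \<rho>: "\<forall>j. norm (z $ j) powr (real (m $ j) / real (Max ((\<lambda>r. lam r $ j) ` residue_box m))) < \<rho> $ j
              \<and> \<rho> $ j < 1"
        show "gen_f t k z =
         (\<Sum>r\<in>residue_box m. (mpow z r / (2 * pi * \<i>) ^ CARD('d)) *s
            torus_integral \<rho> (\<lambda>u.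
              (\<Prod>j\<in>UNIV. pf_kernel (m $ j) (lam r $ j) (mu r $ j) (z $ j) (u $ j)) *s
              gen_f t (k - 1) u))"
          unfolding vec_eq_iff
          by (intro allI has_sum_unique[OF f_step[OF z k]]
                collatz_torus_recursion[OF m_pos lam affine _ _ z f_series[of "k - 1"]]) (use \<rho> in auto)
      next
        fix z :: "complex ^ 'd" and k :: nat
        assume z: "z \<in> punctured_polydisc" and k: "1 \<le> k"
        show "gen_f t k z =
         (\<Sum>r\<in>residue_box m. mpow z r *s
            (\<Sum>(l, \<nu>)\<in>L r. (\<eta> r (l, \<nu>) z / mfact l) *s
               mixed_deriv l (gen_f t (k - 1)) (\<phi> r (l, \<nu>) z)))"
          unfolding vec_eq_iff
          by (intro allI has_sum_unique[OF f_step[OF z k]] recurrence[OF _ _ _ z f_series[of "k - 1"]])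
      next
        fix z :: "complex ^ 'd" and w :: complex
        assume z: "z \<in> punctured_polydisc" and w: "norm w < R_w m A"
        let ?R = "\<Sum>r\<in>residue_box m. mpow z r *s
            (\<Sum>(l, \<nu>)\<in>L r. (\<eta> r (l, \<nu>) z / mfact l) *s
               mixed_deriv l (\<lambda>v. gen_F t v w) (\<phi> r (l, \<nu>) z))"
        note F_series = power_series_deriv_gen_F[OF growth R_w_bound[OF w]]
        show "gen_F t z w = gen_f t 0 z + w *s ?R"
          unfolding vec_eq_iff
        proof
          fix i
          \<comment> \<open>The same recurrence as for f_k, now with the coefficients of F for fixed
            w; w times this sum plus f_0 is then recombined through
            \<open>orbit_series_rec\<close>.\<close>
          have "((\<lambda>n. mpow z n * orbit_series t w i (t n)) has_sum ?R $ i) UNIV"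
            by (rule recurrence[OF _ _ _ z F_series])
          then have "((\<lambda>n. of_nat ((t ^^ 0) n $ i) * mpow z n + w * (mpow z n * orbit_series t w i (t n)))
              has_sum (gen_f t 0 z $ i + w * ?R $ i)) UNIV"
            by (intro has_sum_add has_sum_cmult_right power_series_deriv_0D[OF f_series poly[OF z]])
          moreover have "of_nat ((t ^^ 0) n $ i) * mpow z n + w * (mpow z n * orbit_series t w i (t n)) =
              orbit_series t w i n * mpow z n" for n
            \<comment> \<open>Only the occurrence at \<open>n\<close> is unfolded; the one at
              \<open>t n\<close> has to stay.\<close>
            by (subst (2) orbit_series_rec[OF growth R_w_bound[OF w]]) (simp add: algebra_simps)
          ultimately have "((\<lambda>n. orbit_series t w i n * mpow z n) has_sum (gen_f t 0 z $ i + w * ?R $ i)) UNIV"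
            by (simp only:)
          then show "gen_F t z w $ i = (gen_f t 0 z + w *s ?R) $ i"
            using has_sum_unique[OF power_series_deriv_0D[OF F_series poly[OF z]]] by simp
        qed
      qed
    qed
  qed
qed

end
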